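(* For every integer $r\ge5$, there are exactly nine $r$-Wilf-equivalence classes among the twelve vincular patterns of length three: the classes $\{2\overline{13},2\overline{31}\}$, $\{1\overline{23},1\overline{32}\}$, $\{3\overline{21},3\overline{12}\}$, and six further classes each consisting of a single one of the remaining patterns $\overline{13}2,\ \overline{31}2,\ \overline{12}3,\ \overline{21}3,\ \overline{23}1,\ \overline{32}1$.
   Context: $S_n$ is the set of permutations of $\{1,\ldots,n\}$ written as sequences $(\tau(1),\ldots,\tau(n))$. Three entries $xyz$ form an $abc$ pattern ($abc\in S_3$) if they are in the same relative order as $abc$. Vincular patterns of length three (exactly two entries, under the overline, required to be adjacent): $\tau\in S_n$ contains $a\overline{bc}$ if there exist indices $i<j$ such that $\tau(i)\tau(j)\tau(j+1)$ is an $abc$ pattern; $\tau$ contains $\overline{ab}c$ if there exist indices $i$, $j$ with $i+1<j$ such that $\tau(i)\tau(i+1)\tau(j)$ is an $abc$ pattern; otherwise $\tau$ avoids the vincular pattern. There are twelve such patterns. For $1\le r\le n$, $S_{n,r}(\sigma)$ is the set of $\tau\in S_n$ with $\tau(1)=r$ that avoid $\sigma$. For fixed $r\in\{1,2,\ldots\}$, patterns $\sigma,\sigma'$ are $r$-Wilf equivalent if $|S_{n,r}(\sigma)|=|S_{n,r}(\sigma')|$ for all $n\ge r$. *)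

theory Defs
  imports "HOL-Combinatorics.Permutations"
begin

text \<open>
  Permutations of \<open>{1..n}\<close> are functions with \<open>\<tau> permutes {1..n}\<close>, so that the entries are
  \<open>\<tau> 1, \<dots>, \<tau> n\<close> with the usual indices starting at \<open>1\<close>.
\<close>

definition is_pattern :: "nat \<times> nat \<times> nat \<Rightarrow> nat \<times> nat \<times> nat \<Rightarrow> bool" where
  "is_pattern = (\<lambda>(x, y, z) (a, b, c).
     (x < y \<longleftrightarrow> a < b) \<and> (y < x \<longleftrightarrow> b < a) \<and>
     (x < z \<longleftrightarrow> a < c) \<and> (z < x \<longleftrightarrow> c < a) \<and>
     (y < z \<longleftrightarrow> b < c) \<and> (z < y \<longleftrightarrow> c < b))"

text \<open>
  \<open>AdjLast a b c\<close> is the vincular pattern with the overline above \<open>bc\<close>, and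
  \<open>AdjFirst a b c\<close> the one with the overline above \<open>ab\<close>. Only the words \<open>abc\<close> in \<open>S\<^sub>3\<close>
  give patterns, see \<open>vincular_patterns\<close>.
\<close>

datatype vincular = AdjLast nat nat nat | AdjFirst nat nat nat

definition vincular_patterns :: "vincular set" where
  "vincular_patterns =
     {AdjLast a b c | a b c. distinct [a, b, c] \<and> {a, b, c} = {1..3}} \<union>
     {AdjFirst a b c | a b c. distinct [a, b, c] \<and> {a, b, c} = {1..3}}"

fun contains :: "nat \<Rightarrow> (nat \<Rightarrow> nat) \<Rightarrow> vincular \<Rightarrow> bool" where
  "contains n \<tau> (AdjLast a b c) \<longleftrightarrow>
     (\<exists>i j. 1 \<le> i \<and> i < j \<and> j + 1 \<le> n \<and> is_pattern (\<tau> i, \<tau> j, \<tau> (j + 1)) (a, b, c))"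
| "contains n \<tau> (AdjFirst a b c) \<longleftrightarrow>
     (\<exists>i j. 1 \<le> i \<and> i + 1 < j \<and> j \<le> n \<and> is_pattern (\<tau> i, \<tau> (i + 1), \<tau> j) (a, b, c))"

definition avoiders :: "nat \<Rightarrow> nat \<Rightarrow> vincular \<Rightarrow> (nat \<Rightarrow> nat) set" where
  "avoiders n r \<sigma> = {\<tau>. \<tau> permutes {1..n} \<and> \<tau> 1 = r \<and> \<not> contains n \<tau> \<sigma>}"

definition wilf_rel :: "nat \<Rightarrow> (vincular \<times> vincular) set" where
  "wilf_rel r = {(\<sigma>, \<sigma>'). \<sigma> \<in> vincular_patterns \<and> \<sigma>' \<in> vincular_patterns \<and>
     (\<forall>n\<ge>r. card (avoiders n r \<sigma>) = card (avoiders n r \<sigma>'))}"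

lemma equiv_wilf_rel: "equiv vincular_patterns (wilf_rel r)"
  by (rule equivI) (auto simp: wilf_rel_def refl_on_def sym_def trans_def)

end

theory Submission
  imports Defs "HOL-Combinatorics.Multiset_Permutations"
begin

text \<open>
  Write a permutation as a list and let \<open>p = r - 1\<close> and \<open>q = n - r\<close> be the numbers of entries below and
  above its head. For every pattern the number of avoiders depends only on \<open>p\<close> and \<open>q\<close>, and
  complementation swaps \<open>p\<close> and \<open>q\<close>, so six patterns suffice.

  A list \<open>r # s # zs\<close> avoids a pattern with the overline on the first two letters iff \<open>s # zs\<close> does and \<open>s\<close> is
  not one of the forbidden successors of \<open>r\<close>; the resulting recurrences are solved by Bell numbers and
  ballot numbers. Avoiders of \<open>1-23\<close> and \<open>1-32\<close> are cut at their minimum: the part after it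
  is monotone and the part before it is an arbitrary avoider, so both patterns satisfy the same recurrence.
  In avoiders of \<open>2-13\<close> (\<open>2-31\<close>) all entries above the head come before (after) all
  entries below it, which gives the product of Catalan numbers \<open>C\<^sub>p C\<^sub>q\<close> in both cases.

  The nine classes are separated by the values at \<open>n = r, r + 1, r + 2\<close>, using
  \<open>B\<^bsub>k+1\<^esub> \<ge> 3 B\<^sub>k\<close> for \<open>k \<ge> 3\<close>, and \<open>C\<^sub>k < B\<^sub>k\<close> for \<open>k \<ge> 4\<close>, and \<open>C\<^sub>k < C\<^bsub>k+1\<^esub> < 4 C\<^sub>k\<close> for \<open>k \<ge> 1\<close>.
\<close>

section \<open>Words and complements\<close>

text \<open>The pattern enters only as a predicate on three letters, and lists range over arbitrary
  finite sets of naturals, so deleting a letter never requires renumbering the rest.\<close>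

fun avoids_first :: "(nat \<Rightarrow> nat \<Rightarrow> nat \<Rightarrow> bool) \<Rightarrow> nat list \<Rightarrow> bool" where
  "avoids_first P (x # y # zs) \<longleftrightarrow> (\<forall>z\<in>set zs. \<not> P x y z) \<and> avoids_first P (y # zs)"
| "avoids_first P _ \<longleftrightarrow> True"

fun avoids_last :: "(nat \<Rightarrow> nat \<Rightarrow> nat \<Rightarrow> bool) \<Rightarrow> nat list \<Rightarrow> bool" where
  "avoids_last P (x # xs) \<longleftrightarrow> successively (\<lambda>y z. \<not> P x y z) xs \<and> avoids_last P xs"
| "avoids_last P [] \<longleftrightarrow> True"

lemma avoids_first_nth:
  "avoids_first P xs \<longleftrightarrow> (\<forall>i j. Suc i < j \<longrightarrow> j < length xs \<longrightarrow> \<not> P (xs ! i) (xs ! Suc i) (xs ! j))"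
proof (induction P xs rule: avoids_first.induct)
  case (1 P x y zs)
  have "(\<forall>i j. Suc i < j \<longrightarrow> j < length (x # y # zs) \<longrightarrow>
           \<not> P ((x # y # zs) ! i) ((x # y # zs) ! Suc i) ((x # y # zs) ! j)) \<longleftrightarrow>
        (\<forall>j < length zs. \<not> P x y (zs ! j)) \<and>
        (\<forall>i j. Suc i < j \<longrightarrow> j < length (y # zs) \<longrightarrow>
           \<not> P ((y # zs) ! i) ((y # zs) ! Suc i) ((y # zs) ! j))" (is "?L \<longleftrightarrow> ?M \<and> ?N")
  proof (intro iffI conjI)
    assume L: ?L
    show ?M
      using L[rule_format, of 0 "Suc (Suc _)"] by auto
    show ?N
      using L[rule_format, of "Suc _" "Suc _"] by auto
  next
    assume MN: "?M \<and> ?N"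
    show ?L
    proof (intro allI impI)
      fix i j
      assume ij: "Suc i < j" "j < length (x # y # zs)"
      then obtain j' where j': "j = Suc (Suc j')"
        by (metis Suc_lessE less_imp_Suc_add)
      show "\<not> P ((x # y # zs) ! i) ((x # y # zs) ! Suc i) ((x # y # zs) ! j)"
        using MN[THEN conjunct1] MN[THEN conjunct2, rule_format, of "i - 1" "Suc j'"] ij j'
        by (cases i) auto
    qed
  qed
  then show ?case
    using "1.IH" by (auto simp: all_set_conv_all_nth)
qed auto

lemma avoids_last_nth:
  "avoids_last P xs \<longleftrightarrow> (\<forall>i j. i < j \<longrightarrow> Suc j < length xs \<longrightarrow> \<not> P (xs ! i) (xs ! j) (xs ! Suc j))"
proof (induction P xs rule: avoids_last.induct)
  case (1 P x xs)
  have "(\<forall>i j. i < j \<longrightarrow> Suc j < length (x # xs) \<longrightarrow>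
           \<not> P ((x # xs) ! i) ((x # xs) ! j) ((x # xs) ! Suc j)) \<longleftrightarrow>
        (\<forall>j. Suc j < length xs \<longrightarrow> \<not> P x (xs ! j) (xs ! Suc j)) \<and>
        (\<forall>i j. i < j \<longrightarrow> Suc j < length xs \<longrightarrow> \<not> P (xs ! i) (xs ! j) (xs ! Suc j))"
    (is "?L \<longleftrightarrow> ?M \<and> ?N")
  proof (intro iffI conjI)
    assume L: ?L
    show ?M
      using L[rule_format, of 0 "Suc _"] by auto
    show ?N
      using L[rule_format, of "Suc _" "Suc _"] by auto
  next
    assume MN: "?M \<and> ?N"
    show ?L
    proof (intro allI impI)
      fix i j
      assume ij: "i < j" "Suc j < length (x # xs)"
      then obtain j' where j': "j = Suc j'"
        by (cases j) auto
      show "\<not> P ((x # xs) ! i) ((x # xs) ! j) ((x # xs) ! Suc j)"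
        using MN[THEN conjunct1] MN[THEN conjunct2, rule_format, of "i - 1" j'] ij j'
        by (cases i) auto
    qed
  qed
  then show ?case
    using "1.IH" by (auto simp: successively_conv_nth)
qed auto

fun avoids :: "vincular \<Rightarrow> nat list \<Rightarrow> bool" where
  "avoids (AdjLast a b c) = avoids_last (\<lambda>x y z. is_pattern (x, y, z) (a, b, c))"
| "avoids (AdjFirst a b c) = avoids_first (\<lambda>x y z. is_pattern (x, y, z) (a, b, c))"

text \<open>List positions start at 0 and permutation indices at 1; once avoidance is in index form,
  only this shift has to be bridged.\<close>

lemma avoids_word:
  "avoids \<sigma> (map \<tau> [1..<Suc n]) \<longleftrightarrow> \<not> contains n \<tau> \<sigma>"
proof (cases \<sigma>)
  case (AdjLast a b c)
  let ?P = "\<lambda>i j. is_pattern (\<tau> i, \<tau> j, \<tau> (Suc j)) (a, b, c)"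
  have "(\<exists>i j. i < j \<and> Suc j < n \<and> ?P (Suc i) (Suc j)) \<longleftrightarrow>
        (\<exists>i j. 1 \<le> i \<and> i < j \<and> j + 1 \<le> n \<and> ?P i j)" (is "?L \<longleftrightarrow> ?R")
  proof
    assume ?L
    then show ?R
      by (metis Suc_eq_plus1 Suc_leI Suc_mono le_add2)
  next
    assume ?R
    then obtain i j where ij: "1 \<le> i" "i < j" "j + 1 \<le> n" "?P i j"
      by blast
    then have "i - 1 < j - 1" "Suc (j - 1) < n" "?P (Suc (i - 1)) (Suc (j - 1))"
      by auto
    then show ?L
      by blast
  qed
  then show ?thesis
    unfolding AdjLast avoids.simps avoids_last_nth contains.simps by (auto simp del: upt_Suc)
next
  case (AdjFirst a b c)
  let ?P = "\<lambda>i j. is_pattern (\<tau> i, \<tau> (Suc i), \<tau> j) (a, b, c)"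
  have "(\<exists>i j. Suc i < j \<and> j < n \<and> ?P (Suc i) (Suc j)) \<longleftrightarrow>
        (\<exists>i j. 1 \<le> i \<and> i + 1 < j \<and> j \<le> n \<and> ?P i j)" (is "?L \<longleftrightarrow> ?R")
  proof
    assume ?L
    then show ?R
      by (metis Suc_eq_plus1 Suc_leI Suc_mono le_add2)
  next
    assume ?R
    then obtain i j where ij: "1 \<le> i" "i + 1 < j" "j \<le> n" "?P i j"
      by blast
    then have "Suc (i - 1) < j - 1" "j - 1 < n" "?P (Suc (i - 1)) (Suc (j - 1))"
      by auto
    then show ?L
      by blast
  qed
  then show ?thesis
    unfolding AdjFirst avoids.simps avoids_first_nth contains.simps by (auto simp del: upt_Suc)
qed

text \<open>The head is kept outside the list because it is prescribed for avoiders;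
  \<open>S\<close> is arbitrary so that it can shrink in inductions.\<close>

definition tails :: "(nat list \<Rightarrow> bool) \<Rightarrow> nat set \<Rightarrow> nat \<Rightarrow> nat list set" where
  "tails A S r = {xs. r # xs \<in> permutations_of_set S \<and> A (r # xs)}"

lemma finite_tails [simp]: "finite S \<Longrightarrow> finite (tails A S r)"
  by (rule finite_subset[of _ "tl ` permutations_of_set S"]) (force simp: tails_def)+

lemma card_avoiders:
  assumes "1 \<le> n"
  shows "card (avoiders n r \<sigma>) = card (tails (avoids \<sigma>) {1..n} r)"
proof -
  let ?w = "\<lambda>\<tau>. map \<tau> [1..<Suc n]"
  have up: "[1..<Suc n] = 1 # [2..<Suc n]"
    using assms by (simp add: upt_conv_Cons numeral_2_eq_2 del: upt_Suc)
  have inj: "inj_on ?w (avoiders n r \<sigma>)"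
  proof (rule inj_onI)
    fix \<tau> \<rho>
    assume h: "\<tau> \<in> avoiders n r \<sigma>" "\<rho> \<in> avoiders n r \<sigma>" and eq: "?w \<tau> = ?w \<rho>"
    have "\<tau> i = \<rho> i" for i
    proof (cases "i \<in> {1..n}")
      case True
      then show ?thesis
        using eq by (auto simp del: upt_Suc)
    next
      case False
      then show ?thesis
        using h by (auto simp: avoiders_def permutes_def)
    qed
    then show "\<tau> = \<rho>" by auto
  qed
  have img: "?w ` avoiders n r \<sigma> = (#) r ` tails (avoids \<sigma>) {1..n} r"
  proof (intro equalityI subsetI)
    fix xs
    assume "xs \<in> ?w ` avoiders n r \<sigma>"
    then obtain \<tau> where \<tau>: "\<tau> permutes {1..n}" "\<tau> 1 = r" "\<not> contains n \<tau> \<sigma>" "xs = ?w \<tau>"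
      by (auto simp: avoiders_def)
    have "set xs = {1..n}"
      using permutes_image[OF \<tau>(1)] unfolding \<tau>(4) set_map set_upt
      by (simp add: atLeastLessThanSuc_atLeastAtMost)
    moreover have "distinct xs"
      using permutes_inj_on[OF \<tau>(1)] unfolding \<tau>(4) by (simp add: distinct_map del: upt_Suc)
    moreover have xs: "xs = r # map \<tau> [2..<Suc n]"
      unfolding \<tau>(4) up using \<tau>(2) by simp
    moreover have "avoids \<sigma> xs"
      using avoids_word \<tau>(3,4) by simp
    ultimately have "map \<tau> [2..<Suc n] \<in> tails (avoids \<sigma>) {1..n} r"
      unfolding tails_def permutations_of_set_def by simp
    then show "xs \<in> (#) r ` tails (avoids \<sigma>) {1..n} r"
      unfolding xs by (rule imageI)
  next
    fix xs
    assume "xs \<in> (#) r ` tails (avoids \<sigma>) {1..n} r"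
    then obtain ys where "xs = r # ys" "ys \<in> tails (avoids \<sigma>) {1..n} r"
      by (rule imageE)
    then have xs: "set xs = {1..n}" "distinct xs" "avoids \<sigma> xs" "xs \<noteq> []" "hd xs = r"
      unfolding tails_def permutations_of_set_def by simp_all
    have len: "length xs = n"
      using distinct_card[OF xs(2)] xs(1) by simp
    \<comment> \<open>\<open>permutes\<close> forces the identity outside \<open>{1..n}\<close>, and
      list positions lag one behind indices.\<close>
    define \<tau> where "\<tau> = (\<lambda>i. if i \<in> {1..n} then xs ! (i - 1) else i)"
    have w: "?w \<tau> = xs"
      using len by (intro nth_equalityI) (auto simp: \<tau>_def nth_upt simp del: upt_Suc)
    have "\<tau> permutes {1..n}"
    proof (rule bij_imp_permutes)
      have "\<tau> ` set [1..<Suc n] = set (?w \<tau>)"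
        by (simp del: upt_Suc)
      then have "\<tau> ` {1..n} = {1..n}"
        unfolding w xs(1) by (simp add: atLeastLessThanSuc_atLeastAtMost del: upt_Suc)
      then show "bij_betw \<tau> {1..n} {1..n}"
        by (simp add: bij_betw_def eq_card_imp_inj_on)
    qed (auto simp: \<tau>_def)
    moreover have "\<tau> 1 = r"
      using assms xs(4,5) by (simp add: \<tau>_def hd_conv_nth)
    moreover have "\<not> contains n \<tau> \<sigma>"
      using avoids_word[of \<sigma> \<tau> n] w xs(3) by simp
    ultimately show "xs \<in> ?w ` avoiders n r \<sigma>"
      using w by (intro image_eqI[of _ _ \<tau>]) (auto simp: avoiders_def)
  qed
  have "card (avoiders n r \<sigma>) = card ((#) r ` tails (avoids \<sigma>) {1..n} r)"
    using card_image[OF inj] img by simp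
  then show ?thesis
    by (simp add: card_image)
qed

section \<open>Complementation\<close>

fun flip :: "vincular \<Rightarrow> vincular" where
  "flip (AdjLast a b c) = AdjLast (4 - a) (4 - b) (4 - c)"
| "flip (AdjFirst a b c) = AdjFirst (4 - a) (4 - b) (4 - c)"

text \<open>Subtraction from a common bound reverses the comparisons of the letters and of the
  pattern values alike; the bounds keep truncated subtraction order-reversing.\<close>

lemma is_pattern_flip:
  assumes "x \<le> n" "y \<le> n" "z \<le> n" "a \<le> k" "b \<le> k" "c \<le> k"
  shows "is_pattern (n - x, n - y, n - z) (k - a, k - b, k - c) \<longleftrightarrow> is_pattern (x, y, z) (a, b, c)"
proof -
  have *: "m - u < m - v \<longleftrightarrow> v < u" if "u \<le> m" for m u v :: nat
    using that by arith
  show ?thesis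
    using assms by (simp add: is_pattern_def *) blast
qed

text \<open>Replacing each entry x by n + 1 - x is an involution. It turns occurrences of a pattern
  into occurrences of its complement and moves the first entry n + 1 - r to r.\<close>

lemma card_avoiders_flip:
  assumes "\<sigma> \<in> vincular_patterns" "1 \<le> r" "r \<le> n"
  shows "card (avoiders n r (flip \<sigma>)) = card (avoiders n (n + 1 - r) \<sigma>)"
proof -
  define f where "f = (\<lambda>\<tau> i. if i \<in> {1..n} then n + 1 - \<tau> i else (i::nat))"
  have perm: "f \<tau> permutes {1..n}" if "\<tau> permutes {1..n}" for \<tau>
  proof -
    have "bij_betw (\<lambda>x. n + 1 - x) {1..n} {1..n}"
      by (rule bij_betwI[where g = "\<lambda>x. n + 1 - x"]) auto
    then have "bij_betw ((\<lambda>x. n + 1 - x) \<circ> \<tau>) {1..n} {1..n}"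
      using permutes_imp_bij[OF that] by (rule bij_betw_trans[rotated])
    then have "bij_betw (f \<tau>) {1..n} {1..n}"
      by (rule bij_betw_cong[THEN iffD1, rotated]) (auto simp: f_def)
    then show ?thesis
      by (rule bij_imp_permutes) (auto simp: f_def)
  qed
  have invol: "f (f \<tau>) = \<tau>" if "\<tau> permutes {1..n}" for \<tau>
  proof
    fix i
    show "f (f \<tau>) i = \<tau> i"
      using that permutes_in_image[OF that, of i] by (auto simp: f_def permutes_def)
  qed
  have le4: "a \<le> 4" "b \<le> 4" "c \<le> 4" if "\<sigma> = AdjLast a b c \<or> \<sigma> = AdjFirst a b c" for a b c
  proof -
    have "{a, b, c} = {1..3}"
      using assms(1) that by (auto simp: vincular_patterns_def)
    then have "a \<in> {1..3}" "b \<in> {1..3}" "c \<in> {1..3}"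
      by blast+
    then show "a \<le> 4" "b \<le> 4" "c \<le> 4"
      by auto
  qed
  have cont: "contains n (f \<tau>) (flip \<sigma>) \<longleftrightarrow> contains n \<tau> \<sigma>" if "\<tau> permutes {1..n}" for \<tau>
  proof -
    have le: "\<tau> i \<le> n + 1" if "i \<in> {1..n}" for i
      using permutes_in_image[OF \<open>\<tau> permutes {1..n}\<close>, of i] that by auto
    have *: "is_pattern (f \<tau> i, f \<tau> j, f \<tau> k) (4 - a, 4 - b, 4 - c) \<longleftrightarrow> is_pattern (\<tau> i, \<tau> j, \<tau> k) (a, b, c)"
      if "\<sigma> = AdjLast a b c \<or> \<sigma> = AdjFirst a b c" "i \<in> {1..n}" "j \<in> {1..n}" "k \<in> {1..n}" for a b c i j k
      using is_pattern_flip[OF le le le le4[OF that(1)], OF that(2-4)] that(2-4)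
      by (simp add: f_def)
    show ?thesis
    proof (cases \<sigma>)
      case (AdjLast a b c)
      have "is_pattern (f \<tau> i, f \<tau> j, f \<tau> (j + 1)) (4 - a, 4 - b, 4 - c) \<longleftrightarrow> is_pattern (\<tau> i, \<tau> j, \<tau> (j + 1)) (a, b, c)"
        if "1 \<le> i" "i < j" "j + 1 \<le> n" for i j
        using that AdjLast by (intro *) auto
      then show ?thesis
        unfolding AdjLast flip.simps contains.simps by blast
    next
      case (AdjFirst a b c)
      have "is_pattern (f \<tau> i, f \<tau> (i + 1), f \<tau> j) (4 - a, 4 - b, 4 - c) \<longleftrightarrow> is_pattern (\<tau> i, \<tau> (i + 1), \<tau> j) (a, b, c)"
        if "1 \<le> i" "i + 1 < j" "j \<le> n" for i j
        using that AdjFirst by (intro *) auto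
      then show ?thesis
        unfolding AdjFirst flip.simps contains.simps by blast
    qed
  qed
  have f_first: "f \<tau> (Suc 0) = n + 1 - \<tau> (Suc 0)" for \<tau>
    using assms(2,3) by (simp add: f_def)
  have "bij_betw f (avoiders n (n + 1 - r) \<sigma>) (avoiders n r (flip \<sigma>))"
  proof (rule bij_betwI[where g = f])
    show "f \<in> avoiders n (n + 1 - r) \<sigma> \<rightarrow> avoiders n r (flip \<sigma>)"
      using assms(2,3) perm cont by (auto simp: avoiders_def f_first)
    have "\<not> contains n (f \<tau>) \<sigma>" if "\<tau> permutes {1..n}" "\<not> contains n \<tau> (flip \<sigma>)" for \<tau>
      using cont[OF perm[OF that(1)]] invol[OF that(1)] that(2) by simp
    then show "f \<in> avoiders n r (flip \<sigma>) \<rightarrow> avoiders n (n + 1 - r) \<sigma>"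
      using assms(2,3) perm by (auto simp: avoiders_def f_first)
  qed (auto simp: avoiders_def invol)
  then show ?thesis
    by (simp add: bij_betw_same_card)
qed

section \<open>Overline on the first two letters\<close>

definition below :: "nat set \<Rightarrow> nat \<Rightarrow> nat" where
  "below S r = card {x \<in> S. x < r}"

definition above :: "nat set \<Rightarrow> nat \<Rightarrow> nat" where
  "above S r = card {x \<in> S. r < x}"

lemma card_split_at:
  assumes "finite S" "r \<in> S"
  shows "card S = Suc (below S r + above S r)"
proof -
  have "S = insert r ({x \<in> S. x < r} \<union> {x \<in> S. r < x})"
    using assms by auto
  then have "card S = card (insert r ({x \<in> S. x < r} \<union> {x \<in> S. r < x}))"
    by simp
  also have "\<dots> = Suc (card ({x \<in> S. x < r} \<union> {x \<in> S. r < x}))"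
    using assms by (subst card_insert_disjoint) auto
  also have "\<dots> = Suc (below S r + above S r)"
    unfolding below_def above_def using assms by (subst card_Un_disjoint) auto
  finally show ?thesis .
qed

text \<open>The ranks \<open>below S s\<close> run exactly once through 0, ..., card S - 1: a new
  maximum leaves the old ranks unchanged and itself receives rank \<open>card S\<close>.\<close>

lemma sum_over_ranks:
  assumes "finite S"
  shows "(\<Sum>s\<in>S. g (below S s)) = (\<Sum>i<card S. g i :: nat)"
  using assms
proof (induction S rule: finite_linorder_max_induct)
  case (insert b S)
  have "{x \<in> insert b S. x < s} = {x \<in> S. x < s}" if "s \<in> S" for s
    using insert.hyps(2) that by auto
  then have "below (insert b S) s = below S s" if "s \<in> S" for s
    using that by (simp add: below_def)
  moreover have "{x \<in> insert b S. x < b} = S"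
    using insert.hyps(2) by auto
  then have "below (insert b S) b = card S"
    by (simp add: below_def)
  moreover have "b \<notin> S"
    using insert.hyps(2) by blast
  ultimately show ?case
    using insert.hyps(1) insert.IH by simp
qed simp

text \<open>Let p and q be the numbers of letters below and above r. Removing r does not affect the
  rank i of some s < r, and of the p + q - 1 letters left besides s all but i lie above s.\<close>

lemma sum_below:
  assumes "finite S" "r \<in> S"
  shows "(\<Sum>s\<in>{s \<in> S. s < r}. g (below (S - {r}) s) (above (S - {r}) s)) =
         (\<Sum>i<below S r. g i (below S r + above S r - 1 - i) :: nat)"
proof -
  let ?L = "{s \<in> S. s < r}"
  have "below (S - {r}) s = below ?L s" if "s \<in> ?L" for s
  proof -
    have "{x \<in> S - {r}. x < s} = {x \<in> ?L. x < s}"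
      using that by auto
    then show ?thesis
      by (simp add: below_def)
  qed
  moreover have "above (S - {r}) s = below S r + above S r - 1 - below (S - {r}) s" if "s \<in> ?L" for s
    using card_split_at[of "S - {r}" s] card_split_at[OF assms] assms that by simp
  ultimately have "(\<Sum>s\<in>?L. g (below (S - {r}) s) (above (S - {r}) s)) =
      (\<Sum>s\<in>?L. (\<lambda>i. g i (below S r + above S r - 1 - i)) (below ?L s))"
    by (intro sum.cong) simp_all
  also have "\<dots> = (\<Sum>i<card ?L. g i (below S r + above S r - 1 - i))"
    using assms by (intro sum_over_ranks) simp
  finally show ?thesis
    by (simp add: below_def)
qed

text \<open>All letters below r are also below any s > r, which shifts the lower rank of s by
  \<open>below S r\<close>.\<close>

lemma sum_above:
  assumes "finite S" "r \<in> S"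
  shows "(\<Sum>s\<in>{s \<in> S. r < s}. g (below (S - {r}) s) (above (S - {r}) s)) =
         (\<Sum>i<above S r. g (below S r + i) (above S r - 1 - i) :: nat)"
proof -
  let ?U = "{s \<in> S. r < s}"
  have below: "below (S - {r}) s = below S r + below ?U s" if "s \<in> ?U" for s
  proof -
    have "{x \<in> S - {r}. x < s} = {x \<in> S. x < r} \<union> {x \<in> ?U. x < s}"
      using that by auto
    moreover have "{x \<in> S. x < r} \<inter> {x \<in> ?U. x < s} = {}"
      by auto
    ultimately show ?thesis
      using assms by (simp add: below_def card_Un_disjoint)
  qed
  moreover have "above (S - {r}) s = above S r - 1 - below ?U s" if "s \<in> ?U" for s
    using card_split_at[of "S - {r}" s] card_split_at[OF assms] below[OF that] assms that by simp
  ultimately have "(\<Sum>s\<in>?U. g (below (S - {r}) s) (above (S - {r}) s)) =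
      (\<Sum>s\<in>?U. (\<lambda>i. g (below S r + i) (above S r - 1 - i)) (below ?U s))"
    by (intro sum.cong) simp_all
  also have "\<dots> = (\<Sum>i<card ?U. g (below S r + i) (above S r - 1 - i))"
    using assms by (intro sum_over_ranks) simp
  finally show ?thesis
    by (simp add: above_def)
qed

section \<open>Recurrence over the second letter\<close>

lemma tails_singleton:
  assumes "A [r]"
  shows "tails A {r} r = {[]}"
proof -
  have "xs = []" if "set xs \<subseteq> {r}" "r \<notin> set xs" for xs
    using that by (cases xs) auto
  then show ?thesis
    using assms by (auto simp: tails_def permutations_of_set_def)
qed

definition next_heads :: "(nat \<Rightarrow> nat \<Rightarrow> nat \<Rightarrow> bool) \<Rightarrow> nat set \<Rightarrow> nat \<Rightarrow> nat set" where
  "next_heads P S r = {s \<in> S - {r}. \<forall>z\<in>S - {r, s}. \<not> P r s z}"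

text \<open>The head r occurs in only one adjacent pair, namely with the second letter s, and the
  letters after this pair are exactly those of \<open>S - {r, s}\<close>. So the head restricts the
  choice of s and nothing else.\<close>

lemma tails_avoids_first:
  assumes "finite S" "r \<in> S" "S \<noteq> {r}"
  shows "tails (avoids_first P) S r =
    (\<Union>s\<in>next_heads P S r. (#) s ` tails (avoids_first P) (S - {r}) s)" (is "?L = ?R")
proof (intro equalityI subsetI)
  fix xs
  assume xs: "xs \<in> ?L"
  then obtain s zs where s: "xs = s # zs"
    using assms(3) by (cases xs) (auto simp: tails_def permutations_of_set_def)
  have S: "insert r (insert s (set zs)) = S" and d: "distinct (r # s # zs)"
    and a: "avoids_first P (r # s # zs)"
    using xs unfolding s tails_def permutations_of_set_def by simp_all
  have "set zs = S - {r, s}" "S - {r} = insert s (set zs)"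
    unfolding S[symmetric] using d by auto
  then have "s \<in> next_heads P S r" "zs \<in> tails (avoids_first P) (S - {r}) s"
    using a d S by (auto simp: next_heads_def tails_def permutations_of_set_def)
  then show "xs \<in> ?R"
    using s by blast
next
  fix xs
  assume "xs \<in> ?R"
  then obtain s zs where s: "xs = s # zs" "s \<in> next_heads P S r"
    and zs: "zs \<in> tails (avoids_first P) (S - {r}) s"
    by blast
  have S: "insert s (set zs) = S - {r}" and d: "distinct (s # zs)" and a: "avoids_first P (s # zs)"
    using zs unfolding tails_def permutations_of_set_def by simp_all
  have "insert r (insert s (set zs)) = S" "set zs \<subseteq> S - {r, s}" "r \<notin> insert s (set zs)"
    unfolding S using S d assms(2) by auto
  then show "xs \<in> ?L"
    using a d s by (auto simp: next_heads_def tails_def permutations_of_set_def)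
qed

lemma card_tails_avoids_first:
  assumes "finite S" "r \<in> S" "S \<noteq> {r}"
  shows "card (tails (avoids_first P) S r) =
    (\<Sum>s\<in>next_heads P S r. card (tails (avoids_first P) (S - {r}) s))"
proof -
  have "finite (next_heads P S r)"
    using assms by (simp add: next_heads_def)
  then show ?thesis
    unfolding tails_avoids_first[OF assms] using assms(1)
    by (subst card_UN_disjoint) (auto simp: card_image)
qed

text \<open>Induction on \<open>card S\<close>. It reduces counting to two tasks per pattern:
  finding the admissible second letters, and verifying a numerical recurrence in the two
  ranks.\<close>

lemma card_tails_first_by_ranks:
  assumes base: "f 0 0 = 1"
    and step: "\<And>S r. finite S \<Longrightarrow> r \<in> S \<Longrightarrow> S \<noteq> {r} \<Longrightarrow>
      (\<Sum>s\<in>next_heads P S r. f (below (S - {r}) s) (above (S - {r}) s)) = f (below S r) (above S r)"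
    and "finite S" "r \<in> S"
  shows "card (tails (avoids_first P) S r) = f (below S r) (above S r)"
  using assms(3,4)
proof (induction "card S" arbitrary: S r rule: less_induct)
  case less
  show ?case
  proof (cases "S = {r}")
    case True
    then show ?thesis
      using base by (simp add: tails_singleton below_def above_def cong: conj_cong)
  next
    case False
    have "card (S - {r}) < card S"
      using less.prems by (intro psubset_card_mono) auto
    then have "card (tails (avoids_first P) (S - {r}) s) = f (below (S - {r}) s) (above (S - {r}) s)"
      if "s \<in> next_heads P S r" for s
      using less that by (simp add: next_heads_def)
    then show ?thesis
      using step[OF less.prems False] by (simp add: card_tails_avoids_first[OF less.prems False])
  qed
qed

section \<open>Bell triangle, ballot numbers and the solved recurrences\<close>

fun bell :: "nat \<Rightarrow> nat" where
  "bell 0 = 1"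
| "bell (Suc n) = (\<Sum>k\<le>n. (n choose k) * bell k)"

declare bell.simps(2) [simp del]

text \<open>For p <= m these are the entries of the Bell triangle (Aitken's array): row m starts
  with \<open>bell m\<close> and ends with \<open>bell (Suc m)\<close>.\<close>

definition bell_sum :: "nat \<Rightarrow> nat \<Rightarrow> nat" where
  "bell_sum m p = (\<Sum>j\<le>p. (p choose j) * bell (m - j))"

lemma bell_sum_0 [simp]: "bell_sum m 0 = bell m"
  by (simp add: bell_sum_def)

lemma bell_sum_diag: "bell_sum m m = bell (Suc m)"
proof -
  have "bell_sum m m = (\<Sum>j\<le>m. (m choose (m - j)) * bell (m - j))"
    unfolding bell_sum_def by (intro sum.cong) (auto simp: binomial_symmetric[symmetric])
  also have "\<dots> = (\<Sum>j\<le>m. (m choose j) * bell j)"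
    by (rule sum.reindex_bij_witness[of _ "\<lambda>j. m - j" "\<lambda>j. m - j"]) auto
  finally show ?thesis
    by (simp add: bell.simps)
qed

text \<open>Pascal's rule applied to the binomial coefficients gives the construction rule of the
  Bell triangle.\<close>

lemma bell_sum_Suc: "bell_sum (Suc m) (Suc p) = bell_sum (Suc m) p + bell_sum m p"
proof -
  have "bell_sum (Suc m) (Suc p) =
      bell (Suc m) + (\<Sum>j\<le>p. (Suc p choose Suc j) * bell (m - j))"
    unfolding bell_sum_def by (subst sum.atMost_Suc_shift) simp
  also have "\<dots> = bell_sum m p + (bell (Suc m) + (\<Sum>j\<le>p. (p choose Suc j) * bell (m - j)))"
    by (simp add: bell_sum_def algebra_simps sum.distrib)
  also have "bell (Suc m) + (\<Sum>j\<le>p. (p choose Suc j) * bell (m - j)) =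
      (\<Sum>j\<le>Suc p. (p choose j) * bell (Suc m - j))"
    by (subst sum.atMost_Suc_shift) simp
  also have "\<dots> = bell_sum (Suc m) p"
    by (simp add: bell_sum_def)
  finally show ?thesis
    by simp
qed

lemma bell_sum_eq_sum: "bell_sum (Suc m) p = bell (Suc m) + (\<Sum>i<p. bell_sum m i)"
  by (induction p) (simp_all add: bell_sum_Suc)

lemma bell_eq_sum: "bell (Suc (Suc m)) = bell (Suc m) + (\<Sum>i\<le>m. bell_sum m i)"
  using bell_sum_eq_sum[of m "Suc m"] by (simp add: bell_sum_diag lessThan_Suc_atMost)

text \<open>In these counts the arguments are the numbers of entries below and above the head.\<close>

definition count123 :: "nat \<Rightarrow> nat \<Rightarrow> nat" where
  "count123 p q = (if q = 0 then bell p else bell_sum (p + q - 1) p)"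

text \<open>The summands i < p belong to second letters below the head. The extra term, present when
  q > 0, belongs to the largest letter, which has all p + q - 1 others below it.\<close>

lemma count123_step:
  assumes "0 < p + q"
  shows "count123 p q = (\<Sum>i<p. count123 i (p + q - 1 - i)) + (if q = 0 then 0 else count123 (p + q - 1) 0)"
proof (cases "p + q - 1")
  case 0
  then have "p = 1 \<and> q = 0 \<or> p = 0 \<and> q = 1"
    using assms by auto
  then show ?thesis
    by (auto simp: count123_def bell.simps)
next
  case (Suc m)
  have *: "count123 i (Suc m - i) = bell_sum m i" if "i \<le> m" for i
    using that by (simp add: count123_def)
  show ?thesis
  proof (cases "q = 0")
    case True
    then have "p = Suc (Suc m)"
      using Suc by simp
    \<comment> \<open>The remaining summand i = m + 1 is \<open>count123 (Suc m) 0\<close>, that is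
      \<open>bell (Suc m)\<close>; the others form a whole row of the triangle.\<close>
    moreover have "(\<Sum>i<Suc m. count123 i (Suc m - i)) = (\<Sum>i<Suc m. bell_sum m i)"
      by (intro sum.cong) (auto simp: *)
    ultimately show ?thesis
      using True bell_eq_sum[of m] by (simp add: count123_def lessThan_Suc_atMost)
  next
    case False
    have "(\<Sum>i<p. count123 i (Suc m - i)) = (\<Sum>i<p. bell_sum m i)"
      using Suc False by (intro sum.cong) (auto simp: *)
    then show ?thesis
      using Suc False bell_sum_eq_sum[of m p] by (simp add: count123_def)
  qed
qed

text \<open>A second letter above r has to be \<open>Max S\<close>, since otherwise
  \<open>Max S\<close> comes later and completes a 123. Second letters below r are always
  admissible.\<close>

lemma count_first123:
  assumes "finite S" "r \<in> S"
  shows "card (tails (avoids (AdjFirst 1 2 3)) S r) = count123 (below S r) (above S r)"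
  unfolding avoids.simps
proof (rule card_tails_first_by_ranks[OF _ _ assms])
  fix S :: "nat set" and r
  assume S: "finite S" "r \<in> S" "S \<noteq> {r}"
  let ?L = "{s \<in> S. s < r}" and ?U = "{s \<in> S. r < s}"
  let ?H = "next_heads (\<lambda>x y z. is_pattern (x, y, z) (1, 2, 3)) S r"
  let ?g = "\<lambda>s. count123 (below (S - {r}) s) (above (S - {r}) s)"
  have pos: "0 < below S r + above S r"
    using S card_split_at[OF S(1,2)] card_1_singleton_iff[of S] by fastforce
  have "S \<noteq> {}"
    using S(2) by auto
  note Max_S = Max_in[OF S(1) this] Max_gr_iff[OF S(1) this]
  show "(\<Sum>s\<in>?H. ?g s) = count123 (below S r) (above S r)"
  proof (cases "?U = {}")
    case True
    have "above S r = 0"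
      unfolding above_def True by simp
    moreover have "?H = ?L"
      using True by (auto simp: next_heads_def is_pattern_def)
    ultimately show ?thesis
      using sum_below[OF S(1,2), of count123] count123_step[OF pos] by simp
  next
    case False
    then have "r < Max S"
      using Max_S by auto
    have le_Max: "x \<le> Max S" if "x \<in> S" for x
      using that S(1) by simp
    have "?H = insert (Max S) ?L"
    proof (intro equalityI subsetI)
      fix s assume s: "s \<in> ?H"
      show "s \<in> insert (Max S) ?L"
      proof (rule ccontr)
        assume "s \<notin> insert (Max S) ?L"
        then have "r < s" "s < Max S"
          using s le_Max[of s] by (auto simp: next_heads_def)
        then have "\<not> is_pattern (r, s, Max S) (1, 2, 3)"
          using s Max_S(1) by (auto simp: next_heads_def)
        then show False
          using \<open>r < s\<close> \<open>s < Max S\<close> by (simp add: is_pattern_def)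
      qed
    next
      fix s assume "s \<in> insert (Max S) ?L"
      moreover have "\<not> is_pattern (r, Max S, z) (1, 2, 3)" if "z \<in> S" for z
        using le_Max[OF that] by (simp add: is_pattern_def)
      moreover have "\<not> is_pattern (r, s, z) (1, 2, 3)" if "s < r" for z
        using that by (simp add: is_pattern_def)
      ultimately show "s \<in> ?H"
        using Max_S(1) \<open>r < Max S\<close> unfolding next_heads_def by blast
    qed
    moreover have "Max S \<notin> ?L"
      using \<open>r < Max S\<close> by simp
    ultimately have "(\<Sum>s\<in>?H. ?g s) = ?g (Max S) + (\<Sum>s\<in>?L. ?g s)"
      using S(1) by simp
    moreover have mx: "Max S \<in> S - {r}"
      using \<open>r < Max S\<close> Max_S(1) by auto
    moreover have "{x \<in> S - {r}. Max S < x} = {}"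
      using le_Max by (auto simp: leD)
    then have "above (S - {r}) (Max S) = 0"
      unfolding above_def by (simp only: card.empty)
    moreover have "below (S - {r}) (Max S) = below S r + above S r - 1"
      using card_split_at[OF _ mx] card_split_at[OF S(1,2)] S \<open>above (S - {r}) (Max S) = 0\<close>
      by simp
    moreover have "above S r \<noteq> 0"
      using False S(1) by (simp add: above_def)
    ultimately show ?thesis
      using sum_below[OF S(1,2), of count123] count123_step[OF pos] by simp
  qed
qed (simp add: count123_def)

definition count213 :: "nat \<Rightarrow> nat \<Rightarrow> nat" where
  "count213 p q = (if q = 0 then bell p else bell_sum (p + q - 1) (q - 1))"

text \<open>Along the sum the lower rank grows and the upper rank shrinks, so the summands run
  backwards through an initial segment of a row of the Bell triangle, ending in a Bell
  number.\<close>

lemma count213_step_above: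
  assumes "0 < q"
  shows "count213 p q = (\<Sum>i<q. count213 (p + i) (q - 1 - i))"
proof -
  obtain q' where q: "q = Suc q'"
    using assms by (cases q) auto
  show ?thesis
  proof (cases "p + q'")
    case 0
    then show ?thesis
      using q by (simp add: count213_def)
  next
    case (Suc m)
    \<comment> \<open>The summand i = q' is left out: its upper rank is 0 and its value is
      \<open>bell (Suc m)\<close>.\<close>
    have "(\<Sum>i<q'. count213 (p + i) (q' - i)) = (\<Sum>i<q'. bell_sum m (q' - Suc i))"
    proof (rule sum.cong)
      fix i assume "i \<in> {..<q'}"
      then show "count213 (p + i) (q' - i) = bell_sum m (q' - Suc i)"
        using Suc by (simp add: count213_def)
    qed simp
    also have "\<dots> = (\<Sum>i<q'. bell_sum m i)"
      by (rule sum.nat_diff_reindex)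
    finally show ?thesis
      using q Suc bell_sum_eq_sum[of m q'] by (simp add: count213_def)
  qed
qed

text \<open>A largest and a smallest head lead to the same sum over all remaining letters, so this
  is the case p = 0 of the previous recurrence.\<close>

lemma count213_step_below:
  assumes "0 < p"
  shows "count213 p 0 = (\<Sum>i<p. count213 i (p - 1 - i))"
proof -
  have "count213 p 0 = count213 0 p"
    using assms bell_sum_diag[of "p - 1"] by (simp add: count213_def)
  then show ?thesis
    using count213_step_above[OF assms, of 0] by simp
qed

text \<open>If some letter exceeds r, it would complete a 213 with any second letter below r, so the
  second letter must lie above r. If r is the maximum, every second letter is admissible.\<close>

lemma count_first213:
  assumes "finite S" "r \<in> S"
  shows "card (tails (avoids (AdjFirst 2 1 3)) S r) = count213 (below S r) (above S r)"
  unfolding avoids.simps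
proof (rule card_tails_first_by_ranks[OF _ _ assms])
  fix S :: "nat set" and r
  assume S: "finite S" "r \<in> S" "S \<noteq> {r}"
  let ?L = "{s \<in> S. s < r}" and ?U = "{s \<in> S. r < s}"
  let ?H = "next_heads (\<lambda>x y z. is_pattern (x, y, z) (2, 1, 3)) S r"
  have pos: "0 < below S r + above S r"
    using S card_split_at[OF S(1,2)] card_1_singleton_iff[of S] by fastforce
  show "(\<Sum>s\<in>?H. count213 (below (S - {r}) s) (above (S - {r}) s)) = count213 (below S r) (above S r)"
  proof (cases "?U = {}")
    case True
    have "above S r = 0"
      unfolding above_def True by simp
    moreover have "?H = ?L"
      using True by (auto simp: next_heads_def is_pattern_def)
    ultimately show ?thesis
      using pos sum_below[OF S(1,2), of count213] count213_step_below by simp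
  next
    case False
    then have "0 < above S r" "?H = ?U"
      using S(1) by (auto simp: above_def next_heads_def is_pattern_def card_gt_0_iff)
    then show ?thesis
      using sum_above[OF S(1,2), of count213] count213_step_above by simp
  qed
qed (simp add: count213_def)

text \<open>Catalan's triangle of ballot numbers, with the Catalan numbers on the diagonal. The
  minimum cuts the sum off at the end of row n when p = n + 1.\<close>

primrec ballot :: "nat \<Rightarrow> nat \<Rightarrow> nat" where
  "ballot 0 p = 1"
| "ballot (Suc n) p = (\<Sum>i\<le>min p n. ballot n i)"

text \<open>A second letter above r has to be the least one there, since otherwise that least letter
  comes later and completes a 132. It contributes the summand i = p after those for i < p from the
  letters below r.\<close>

lemma count_first132:
  assumes "finite S" "r \<in> S"
  shows "card (tails (avoids (AdjFirst 1 3 2)) S r) = ballot (below S r + above S r) (below S r)"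
  unfolding avoids.simps
proof (rule card_tails_first_by_ranks[of "\<lambda>p q. ballot (p + q) p", OF _ _ assms])
  fix S :: "nat set" and r
  assume S: "finite S" "r \<in> S" "S \<noteq> {r}"
  let ?L = "{s \<in> S. s < r}" and ?U = "{s \<in> S. r < s}"
  let ?H = "next_heads (\<lambda>x y z. is_pattern (x, y, z) (1, 3, 2)) S r"
  let ?g = "\<lambda>s. ballot (below (S - {r}) s + above (S - {r}) s) (below (S - {r}) s)"
  have pos: "0 < below S r + above S r"
    using S card_split_at[OF S(1,2)] card_1_singleton_iff[of S] by fastforce
  then obtain n where n: "below S r + above S r = Suc n"
    by (cases "below S r + above S r") auto
  have L: "(\<Sum>s\<in>?L. ?g s) = (\<Sum>i<below S r. ballot n i)"
    unfolding sum_below[OF S(1,2), of "\<lambda>p q. ballot (p + q) p"] using n by (intro sum.cong) auto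
  show "(\<Sum>s\<in>?H. ?g s) = ballot (below S r + above S r) (below S r)"
  proof (cases "?U = {}")
    case True
    have "above S r = 0"
      unfolding above_def True by simp
    moreover have "?H = ?L"
      using True by (auto simp: next_heads_def is_pattern_def)
    ultimately show ?thesis
      using L n by (simp add: lessThan_Suc_atMost)
  next
    case False
    have U: "Min ?U \<in> ?U" "finite ?U"
      using Min_in[OF _ False] S(1) by auto
    have "?H = insert (Min ?U) ?L"
    proof (intro equalityI subsetI)
      fix s assume s: "s \<in> ?H"
      show "s \<in> insert (Min ?U) ?L"
      proof (rule ccontr)
        assume "s \<notin> insert (Min ?U) ?L"
        then have "s \<in> ?U" "s \<noteq> Min ?U"
          using s by (auto simp: next_heads_def)
        then have "Min ?U < s"
          using Min_le[OF U(2)] by fastforce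
        moreover have "\<not> is_pattern (r, s, Min ?U) (1, 3, 2)"
          using s U(1) \<open>s \<noteq> Min ?U\<close> by (auto simp: next_heads_def)
        ultimately show False
          using U(1) by (auto simp: is_pattern_def)
      qed
    next
      fix s assume "s \<in> insert (Min ?U) ?L"
      moreover have "\<not> z < Min ?U" if "z \<in> S" "r < z" for z
        using that Min_le[OF U(2), of z] by auto
      ultimately show "s \<in> ?H"
        using U(1) by (auto simp: next_heads_def is_pattern_def)
    qed
    moreover have "Min ?U \<notin> ?L"
      using U(1) by auto
    \<comment> \<open>Only r itself separates the lower letters from \<open>Min ?U\<close>, so with
      r removed the lower rank stays the same.\<close>
    moreover have "{x \<in> S - {r}. x < Min ?U} = ?L"
      using U Min_le[OF U(2)] by fastforce
    then have "below (S - {r}) (Min ?U) = below S r"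
      by (simp add: below_def)
    moreover have "below (S - {r}) (Min ?U) + above (S - {r}) (Min ?U) = n"
      using card_split_at[of "S - {r}" "Min ?U"] card_split_at[OF S(1,2)] S U(1) n by auto
    ultimately have "(\<Sum>s\<in>?H. ?g s) = ballot n (below S r) + (\<Sum>i<below S r. ballot n i)"
      using S(1) L by simp
    moreover have "0 < above S r"
      using U by (auto simp: above_def card_gt_0_iff)
    then have "below S r \<le> n"
      using n by simp
    ultimately show ?thesis
      using sum.lessThan_Suc[of "ballot n" "below S r"] by (simp add: n lessThan_Suc_atMost)
  qed
qed simp

section \<open>Cutting at the minimum\<close>

lemma sum_Pow_card:
  assumes "finite X"
  shows "(\<Sum>A\<in>Pow X. g (card A)) = (\<Sum>k\<le>card X. (card X choose k) * g k :: nat)"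
proof -
  have "(\<Sum>A\<in>Pow X. g (card A)) = (\<Sum>k\<le>card X. \<Sum>A\<in>{A \<in> Pow X. card A = k}. g (card A))"
    using assms by (intro sum.group[symmetric]) (auto intro: card_mono)
  also have "\<dots> = (\<Sum>k\<le>card X. (card X choose k) * g k)"
    using n_subsets[OF assms] by (intro sum.cong) (simp_all add: Pow_def)
  finally show ?thesis .
qed

text \<open>If p = 0 the head is the minimum and the rest is forced. Otherwise p + 1 lower letters
  include the minimum, and i of the other p and l of the q upper letters are chosen to stand before
  it.\<close>

fun count_split_min :: "nat \<Rightarrow> nat \<Rightarrow> nat" where
  "count_split_min 0 q = 1"
| "count_split_min (Suc p) q =
     (\<Sum>i\<le>p. (p choose i) * (\<Sum>l\<le>q. (q choose l) * count_split_min i l))"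

text \<open>Summed form of Pascal's rule; applied to \<open>bell\<close> it expresses a Bell number
  through sums of two consecutive ones.\<close>

lemma sum_binomial_Suc:
  "(\<Sum>j\<le>Suc p. (Suc p choose j) * g j) = (\<Sum>j\<le>p. (p choose j) * (g j + g (Suc j)) :: nat)"
proof -
  have "(\<Sum>j\<le>Suc p. (Suc p choose j) * g j) =
      g 0 + (\<Sum>j\<le>p. (p choose Suc j) * g (Suc j)) + (\<Sum>j\<le>p. (p choose j) * g (Suc j))"
    by (subst sum.atMost_Suc_shift) (simp add: algebra_simps sum.distrib)
  also have "g 0 + (\<Sum>j\<le>p. (p choose Suc j) * g (Suc j)) = (\<Sum>j\<le>Suc p. (p choose j) * g j)"
    by (subst sum.atMost_Suc_shift) simp
  finally show ?thesis
    by (simp add: algebra_simps sum.distrib)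
qed

lemma count_split_min_0: "count_split_min p 0 = bell p"
proof (induction p rule: less_induct)
  case (less p)
  then show ?case
    by (cases p) (auto simp: bell.simps intro!: sum.cong)
qed

lemma count_split_min_1: "count_split_min p 1 = bell (Suc p)"
proof (induction p rule: less_induct)
  case (less p)
  show ?case
  proof (cases p)
    case (Suc p')
    have "count_split_min p 1 = (\<Sum>i\<le>p'. (p' choose i) * (bell i + bell (Suc i)))"
      using less Suc by (auto simp: count_split_min_0 intro!: sum.cong)
    then show ?thesis
      using Suc by (simp add: sum_binomial_Suc[symmetric] bell.simps(2)[of "Suc _"] del: sum.atMost_Suc)
  qed (simp add: bell.simps)
qed

text \<open>The inner sum for q = 2 is B_i + 2 B_{i+1} plus the count at i. Adding B_i completes it
  to B_i + 2 B_{i+1} + B_{i+2} by induction, and two uses of Pascal's rule in summed form collapse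
  the result. The additive form avoids truncated subtraction.\<close>

lemma count_split_min_2: "count_split_min p 2 + bell p = bell (Suc (Suc p))"
proof (induction p rule: less_induct)
  case (less p)
  show ?case
  proof (cases p)
    case (Suc p')
    have "count_split_min p 2 + bell p =
        (\<Sum>i\<le>p'. (p' choose i) * (bell i + 2 * bell (Suc i) + count_split_min i 2)) +
        (\<Sum>i\<le>p'. (p' choose i) * bell i)"
      using Suc count_split_min_1 by (simp add: count_split_min_0 bell.simps numeral_2_eq_2)
    also have "\<dots> = (\<Sum>i\<le>p'. (p' choose i) * (bell i + 2 * bell (Suc i) + (count_split_min i 2 + bell i)))"
      by (simp add: sum.distrib[symmetric] algebra_simps)
    also have "\<dots> = (\<Sum>i\<le>p'. (p' choose i) *
        (bell i + bell (Suc i) + (bell (Suc i) + bell (Suc (Suc i)))))"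
      using less Suc by (intro sum.cong) auto
    also have "\<dots> = bell (Suc (Suc (Suc p')))"
      unfolding bell.simps(2)[of "Suc (Suc p')"] sum_binomial_Suc[of "Suc p'" bell]
        sum_binomial_Suc[of p' "\<lambda>j. bell j + bell (Suc j)"] by simp
    finally show ?thesis
      using Suc by simp
  qed (simp add: bell.simps)
qed

lemma count_split_min_Suc_0: "count_split_min (Suc 0) q = 2 ^ q"
  using choose_row_sum[of q] by (simp add: atMost_atLeast0)

text \<open>With m as first letter, every adjacent pair after m is tested against \<open>R\<close>
  alone, which is the strictest test and covers all earlier first letters too. Pairs containing m
  are harmless for earlier letters because those exceed m. Hence the two parts do not
  interact.\<close>

lemma avoids_last_split_min:
  assumes P: "\<And>x y z. P x y z \<longleftrightarrow> x < y \<and> x < z \<and> R y z"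
    and min: "\<And>x. x \<in> set us \<union> set vs \<Longrightarrow> m < x"
  shows "avoids_last P (us @ m # vs) \<longleftrightarrow> avoids_last P us \<and> successively (\<lambda>y z. \<not> R y z) vs"
  using min
proof (induction us)
  case Nil
  have "successively (\<lambda>y z. \<not> P m y z) vs \<longleftrightarrow> successively (\<lambda>y z. \<not> R y z) vs"
    using Nil by (intro successively_cong) (auto simp: P)
  moreover have "avoids_last P vs" if "successively (\<lambda>y z. \<not> R y z) vs"
    using that by (induction vs) (auto simp: P successively_Cons intro: successively_mono)
  ultimately show ?case
    by auto
next
  case (Cons x us)
  have "m < x"
    using Cons.prems by simp
  then have "\<not> P x y m" "\<not> P x m y" for y
    by (auto simp: P)
  then have "successively (\<lambda>y z. \<not> P x y z) (us @ m # vs) \<longleftrightarrow>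
      successively (\<lambda>y z. \<not> P x y z) us \<and> successively (\<lambda>y z. \<not> P x y z) vs"
    by (auto simp: successively_append_iff successively_Cons)
  moreover have "successively (\<lambda>y z. \<not> P x y z) vs" if "successively (\<lambda>y z. \<not> R y z) vs"
    using that by (rule successively_mono) (auto simp: P)
  ultimately show ?case
    using Cons by auto
qed

lemma tails_avoids_last_Min:
  assumes P: "\<And>x y z. P x y z \<longleftrightarrow> x < y \<and> x < z \<and> R y z"
    and w: "\<And>V xs. finite V \<Longrightarrow> xs \<in> permutations_of_set V \<and> successively (\<lambda>y z. \<not> R y z) xs \<longleftrightarrow> xs = w V"
    and S: "finite S" "m \<in> S" "\<And>x. x \<in> S \<Longrightarrow> m \<le> x"
  shows "tails (avoids_last P) S m = {w (S - {m})}"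
proof -
  have "xs \<in> tails (avoids_last P) S m \<longleftrightarrow>
      xs \<in> permutations_of_set (S - {m}) \<and> successively (\<lambda>y z. \<not> R y z) xs" for xs
  proof (cases "xs \<in> permutations_of_set (S - {m})")
    case True
    then have "m < x" if "x \<in> set xs" for x
      using that S(3)[of x] by (auto simp: permutations_of_set_def)
    then show ?thesis
      using True S(2) avoids_last_split_min[of P R "[]" xs m] P
      by (auto simp: tails_def permutations_of_set_def)
  next
    case False
    then show ?thesis
      using S(2) by (auto simp: tails_def permutations_of_set_def)
  qed
  then show ?thesis
    using w[of "S - {m}"] S(1) by auto
qed

text \<open>\<open>U\<close> collects the letters before the minimum, head included. Any avoider on
  \<open>U\<close> may stand there, and the letters after the minimum are then forced into the order
  given by \<open>w\<close>.\<close>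

lemma tails_avoids_last_split:
  assumes P: "\<And>x y z. P x y z \<longleftrightarrow> x < y \<and> x < z \<and> R y z"
    and w: "\<And>V xs. finite V \<Longrightarrow> xs \<in> permutations_of_set V \<and> successively (\<lambda>y z. \<not> R y z) xs \<longleftrightarrow> xs = w V"
    and S: "finite S" "m \<in> S" "\<And>x. x \<in> S \<Longrightarrow> m \<le> x" and r: "r \<noteq> m"
  shows "tails (avoids_last P) S r =
    (\<Union>U\<in>{U. r \<in> U \<and> U \<subseteq> S - {m}}. (\<lambda>xs. xs @ m # w (S - {m} - U)) ` tails (avoids_last P) U r)"
    (is "?L = ?R")
proof (intro equalityI subsetI)
  fix zs assume "zs \<in> ?L"
  then have zs: "insert r (set zs) = S" "distinct (r # zs)" "avoids_last P (r # zs)"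
    unfolding tails_def permutations_of_set_def by simp_all
  then have "m \<in> set zs"
    using S(2) r by auto
  then obtain us vs where uv: "zs = us @ m # vs"
    by (auto simp: in_set_conv_decomp)
  have "m < x" if "x \<in> set (r # us) \<union> set vs" for x
    using zs(1,2) that S(3)[of x] r unfolding uv by (force simp: le_less)
  then have av: "avoids_last P (r # us)" "successively (\<lambda>y z. \<not> R y z) vs"
    using zs(3) avoids_last_split_min[of P R "r # us" vs m, OF P] unfolding uv by simp_all
  have "set vs = S - {m} - insert r (set us)"
    using zs(1,2) unfolding uv by auto
  then have "vs = w (S - {m} - insert r (set us))"
    using w[of "S - {m} - insert r (set us)" vs] S(1) av(2) zs(2)
    unfolding uv by (simp add: permutations_of_set_def)
  moreover have "us \<in> tails (avoids_last P) (insert r (set us)) r"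
    using av(1) zs(2) unfolding uv tails_def permutations_of_set_def by simp
  moreover have "insert r (set us) \<subseteq> S - {m}"
    using zs(1,2) r unfolding uv by auto
  ultimately show "zs \<in> ?R"
    unfolding uv by blast
next
  fix zs assume "zs \<in> ?R"
  then obtain U us where U: "r \<in> U" "U \<subseteq> S - {m}" and us: "us \<in> tails (avoids_last P) U r"
    and zs: "zs = us @ m # w (S - {m} - U)"
    by blast
  let ?v = "w (S - {m} - U)"
  have u: "insert r (set us) = U" "distinct (r # us)" "avoids_last P (r # us)"
    using us unfolding tails_def permutations_of_set_def by simp_all
  have v: "set ?v = S - {m} - U" "distinct ?v" "successively (\<lambda>y z. \<not> R y z) ?v"
    using w[of "S - {m} - U" ?v] S(1) by (auto simp: permutations_of_set_def)
  have "m < x" if "x \<in> set (r # us) \<union> set ?v" for x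
    using that u(1) v(1) U S(3)[of x] by (force simp: le_less)
  then have "avoids_last P (r # zs)"
    using u v avoids_last_split_min[of P R "r # us" ?v m, OF P] unfolding zs by simp
  moreover have "insert r (set zs) = S"
    using u(1) v(1) U(2) S(2) unfolding zs by auto
  moreover have "distinct (r # zs)"
    using u(1,2) v(1,2) U r unfolding zs by auto
  ultimately show "zs \<in> ?L"
    unfolding tails_def permutations_of_set_def by simp
qed

lemma sum_subsets_by_ranks:
  assumes "finite S" "r \<in> S"
  shows "(\<Sum>U\<in>{U. r \<in> U \<and> U \<subseteq> S}. g (below U r) (above U r)) =
    (\<Sum>i\<le>below S r. (below S r choose i) * (\<Sum>l\<le>above S r. (above S r choose l) * g i l) :: nat)"
proof -
  let ?X = "{x \<in> S. x < r}" and ?Y = "{x \<in> S. r < x}"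
  let ?lo = "\<lambda>U. {x \<in> U. x < r}" and ?hi = "\<lambda>U. {x \<in> U. r < x}"
  have split: "?lo (insert r (A \<union> B)) = A" "?hi (insert r (A \<union> B)) = B"
    if "A \<in> Pow ?X" "B \<in> Pow ?Y" for A B
    using that by auto
  have join: "insert r (?lo U \<union> ?hi U) = U" if "r \<in> U" for U
    using that by auto
  have "(\<Sum>U\<in>{U. r \<in> U \<and> U \<subseteq> S}. g (below U r) (above U r)) =
      (\<Sum>(A, B)\<in>Pow ?X \<times> Pow ?Y. g (card A) (card B))"
    using assms join split
    by (intro sum.reindex_bij_witness[of _ "\<lambda>(A, B). insert r (A \<union> B)" "\<lambda>U. (?lo U, ?hi U)"])
      (auto simp: below_def above_def)
  also have "\<dots> = (\<Sum>A\<in>Pow ?X. \<Sum>B\<in>Pow ?Y. g (card A) (card B))"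
    by (rule sum.cartesian_product[symmetric])
  also have "\<dots> = (\<Sum>A\<in>Pow ?X. \<Sum>l\<le>above S r. (above S r choose l) * g (card A) l)"
    using assms(1) by (simp add: sum_Pow_card above_def)
  also have "\<dots> = (\<Sum>i\<le>below S r. (below S r choose i) * (\<Sum>l\<le>above S r. (above S r choose l) * g i l))"
    using assms(1) by (subst sum_Pow_card) (simp_all add: below_def)
  finally show ?thesis .
qed

lemma card_tails_split_min:
  assumes P: "\<And>x y z. P x y z \<longleftrightarrow> x < y \<and> x < z \<and> R y z"
    and w: "\<And>V xs. finite V \<Longrightarrow> xs \<in> permutations_of_set V \<and> successively (\<lambda>y z. \<not> R y z) xs \<longleftrightarrow> xs = w V"
    and "finite S" "r \<in> S"
  shows "card (tails (avoids_last P) S r) = count_split_min (below S r) (above S r)"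
  using assms(3,4)
proof (induction "card S" arbitrary: S rule: less_induct)
  case less
  define m where "m = Min S"
  have "S \<noteq> {}"
    using less.prems(2) by blast
  then have m: "m \<in> S" "\<And>x. x \<in> S \<Longrightarrow> m \<le> x"
    using less.prems(1) by (auto simp: m_def)
  show ?case
  proof (cases "r = m")
    case True
    then have "{x \<in> S. x < r} = {}"
      using m(2) by (auto simp: leD)
    then have "below S r = 0"
      unfolding below_def by (simp only: card.empty)
    then show ?thesis
      using True tails_avoids_last_Min[of P R w S m, OF P w less.prems(1) m] by simp
  next
    case False
    let ?\<U> = "{U. r \<in> U \<and> U \<subseteq> S - {m}}"
    have fin: "finite U" if "U \<in> ?\<U>" for U
      using that less.prems(1) by (auto intro: finite_subset)
    \<comment> \<open>The minimum occurs once, so the part before it, and with it \<open>U\<close>,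
      can be read off the list. This makes the union disjoint.\<close>
    have prefix: "takeWhile (\<lambda>x. x \<noteq> m) (us @ m # vs) = us" if "m \<notin> set us" for us vs
      using that by (subst takeWhile_append2) auto
    have "finite ?\<U>"
      using less.prems(1) by (intro finite_subset[of ?\<U> "Pow S"]) auto
    moreover have "(\<lambda>xs. xs @ m # w (S - {m} - U)) ` tails (avoids_last P) U r \<inter>
        (\<lambda>xs. xs @ m # w (S - {m} - V)) ` tails (avoids_last P) V r = {}"
      if UV: "U \<in> ?\<U>" "V \<in> ?\<U>" "U \<noteq> V" for U V
    proof (rule ccontr)
      assume "\<not> ?thesis"
      then obtain us vs where *: "us \<in> tails (avoids_last P) U r" "vs \<in> tails (avoids_last P) V r"
        "us @ m # w (S - {m} - U) = vs @ m # w (S - {m} - V)"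
        by blast
      then have uv: "insert r (set us) = U" "insert r (set vs) = V"
        by (simp_all add: tails_def permutations_of_set_def)
      then have "m \<notin> set us" "m \<notin> set vs"
        using UV by auto
      then have "us = vs"
        using arg_cong[OF *(3), of "takeWhile (\<lambda>x. x \<noteq> m)"] prefix by simp
      then show False
        using uv UV(3) by simp
    qed
    ultimately have "card (\<Union>U\<in>?\<U>. (\<lambda>xs. xs @ m # w (S - {m} - U)) ` tails (avoids_last P) U r) =
        (\<Sum>U\<in>?\<U>. card ((\<lambda>xs. xs @ m # w (S - {m} - U)) ` tails (avoids_last P) U r))"
      using fin by (intro card_UN_disjoint ballI impI finite_imageI finite_tails) simp_all
    then have "card (tails (avoids_last P) S r) =
        (\<Sum>U\<in>?\<U>. card ((\<lambda>xs. xs @ m # w (S - {m} - U)) ` tails (avoids_last P) U r))"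
      using tails_avoids_last_split[of P R w S m r, OF P w less.prems(1) m False] by simp
    also have "\<dots> = (\<Sum>U\<in>?\<U>. card (tails (avoids_last P) U r))"
      by (intro sum.cong refl card_image) (simp add: inj_on_def)
    also have "\<dots> = (\<Sum>U\<in>?\<U>. count_split_min (below U r) (above U r))"
    proof (rule sum.cong)
      fix U assume U: "U \<in> ?\<U>"
      then have "card U < card S"
        using m(1) less.prems(1) by (intro psubset_card_mono) auto
      then show "card (tails (avoids_last P) U r) = count_split_min (below U r) (above U r)"
        using less.hyps U fin[OF U] by simp
    qed simp
    also have "\<dots> = (\<Sum>i\<le>below (S - {m}) r. (below (S - {m}) r choose i) *
        (\<Sum>l\<le>above (S - {m}) r. (above (S - {m}) r choose l) * count_split_min i l))"
      using less.prems False by (intro sum_subsets_by_ranks) auto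
    also have "\<dots> = count_split_min (Suc (below (S - {m}) r)) (above (S - {m}) r)"
      by simp
    finally have "card (tails (avoids_last P) S r) =
        count_split_min (Suc (below (S - {m}) r)) (above (S - {m}) r)" .
    moreover have "{x \<in> S - {m}. r < x} = {x \<in> S. r < x}"
      using m(2)[OF less.prems(2)] by auto
    then have ab: "above (S - {m}) r = above S r"
      by (simp add: above_def)
    \<comment> \<open>The minimum lies below r, so its removal lowers this rank by one, as in the
      second equation of \<open>count_split_min\<close>.\<close>
    moreover have "Suc (below (S - {m}) r) = below S r"
      using card_split_at[of "S - {m}" r] card_split_at[OF less.prems] less.prems False ab
        card.remove[OF less.prems(1) m(1)] by simp
    ultimately show ?thesis
      by simp
  qed
qed

text \<open>After the minimum no adjacent ascent may occur, so that part is the decreasing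
  arrangement. For 1-32 it is the increasing one, with the same count.\<close>

lemma count_last123:
  assumes "finite S" "r \<in> S"
  shows "card (tails (avoids (AdjLast 1 2 3)) S r) = count_split_min (below S r) (above S r)"
  unfolding avoids.simps
proof (rule card_tails_split_min[where R = "(<)" and w = "\<lambda>V. rev (sorted_list_of_set V)", OF _ _ assms])
  fix V :: "nat set" and xs
  assume V: "finite V"
  have "xs = rev (sorted_list_of_set V) \<longleftrightarrow> rev xs = sorted_list_of_set V"
    by (metis rev_rev_ident)
  also have "\<dots> \<longleftrightarrow> sorted (rev xs) \<and> distinct xs \<and> set xs = V"
    using V sorted_list_of_set_unique[of V "rev xs"] by (auto simp: strict_sorted_iff distinct_card)
  also have "sorted (rev xs) \<longleftrightarrow> successively (\<lambda>y z. \<not> y < z) xs"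
    unfolding sorted_wrt_rev not_less by (subst successively_conv_sorted_wrt) (auto simp: transp_def)
  finally show "xs \<in> permutations_of_set V \<and> successively (\<lambda>y z. \<not> y < z) xs \<longleftrightarrow>
      xs = rev (sorted_list_of_set V)"
    by (auto simp: permutations_of_set_def)
qed (auto simp: is_pattern_def)

lemma count_last132:
  assumes "finite S" "r \<in> S"
  shows "card (tails (avoids (AdjLast 1 3 2)) S r) = count_split_min (below S r) (above S r)"
  unfolding avoids.simps
proof (rule card_tails_split_min[where R = "(>)" and w = sorted_list_of_set, OF _ _ assms])
  fix V :: "nat set" and xs
  assume V: "finite V"
  have "xs = sorted_list_of_set V \<longleftrightarrow> sorted xs \<and> distinct xs \<and> set xs = V"
    using V sorted_list_of_set_unique[of V xs] by (auto simp: strict_sorted_iff distinct_card)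
  also have "sorted xs \<longleftrightarrow> successively (\<lambda>y z. \<not> y > z) xs"
    unfolding not_less by (subst successively_conv_sorted_wrt) (auto simp: transp_def)
  finally show "xs \<in> permutations_of_set V \<and> successively (\<lambda>y z. \<not> y > z) xs \<longleftrightarrow>
      xs = sorted_list_of_set V"
    by (auto simp: permutations_of_set_def)
qed (auto simp: is_pattern_def)

section \<open>Catalan products\<close>

fun catalan :: "nat \<Rightarrow> nat" where
  "catalan 0 = 1"
| "catalan (Suc n) = (\<Sum>i\<le>n. catalan i * catalan (n - i))"

declare catalan.simps(2) [simp del]

definition avoiding_lists :: "(nat \<Rightarrow> nat \<Rightarrow> nat \<Rightarrow> bool) \<Rightarrow> nat set \<Rightarrow> nat list set" where
  "avoiding_lists P V = {xs \<in> permutations_of_set V. avoids_last P xs}"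

text \<open>In an occurrence x lies strictly between y and z with respect to \<open>R\<close>;
  \<open>R = (<)\<close> gives 2-13 and \<open>R = (>)\<close> gives 2-31. If x is in
  \<open>hs\<close>, then z lies beyond x and cannot be in \<open>ls\<close>, so no occurrence
  straddles the two blocks.\<close>

lemma avoids_last_append:
  fixes R :: "nat \<Rightarrow> nat \<Rightarrow> bool"
  assumes P: "\<And>x y z. P x y z \<longleftrightarrow> R y x \<and> R x z" and R: "\<And>x y. R x y \<Longrightarrow> \<not> R y x"
    and hl: "\<And>x y. x \<in> set hs \<Longrightarrow> y \<in> set ls \<Longrightarrow> R y x"
  shows "avoids_last P (hs @ ls) \<longleftrightarrow> avoids_last P hs \<and> avoids_last P ls"
  using hl
proof (induction hs)
  case (Cons x hs)
  have no: "\<not> P x y z" if "z \<in> set ls" for y z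
    using Cons.prems[of x z] that R[of z x] by (auto simp: P)
  then have "successively (\<lambda>y z. \<not> P x y z) ls"
    by (auto simp: successively_conv_nth)
  moreover have "ls = [] \<or> \<not> P x y (hd ls)" for y
    using no[of "hd ls" y] by auto
  ultimately show ?case
    using Cons by (auto simp: successively_append_iff)
qed simp

text \<open>No adjacent step leads from the lower side of r to the upper side, so a list that has
  reached the lower side stays there.\<close>

lemma successively_avoid_eq_append:
  fixes R :: "nat \<Rightarrow> nat \<Rightarrow> bool"
  assumes total: "\<And>x. x \<in> set xs \<Longrightarrow> R r x \<noteq> R x r"
    and succ: "successively (\<lambda>y z. \<not> (R y r \<and> R r z)) xs"
  shows "xs = filter (R r) xs @ filter (\<lambda>x. R x r) xs"
proof -
  have low: "filter (R r) xs = []" if "\<forall>x\<in>set xs. R r x \<noteq> R x r"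
    "successively (\<lambda>y z. \<not> (R y r \<and> R r z)) xs" "xs \<noteq> []" "R (hd xs) r" for xs
    using that
  proof (induction xs)
    case (Cons x xs)
    then show ?case
      by (cases xs) auto
  qed simp
  have "\<forall>x\<in>set xs. R r x \<noteq> R x r"
    using total by blast
  then show ?thesis
    using succ
  proof (induction xs)
    case (Cons y ys)
    have IH: "ys = filter (R r) ys @ filter (\<lambda>x. R x r) ys"
      using Cons by (auto simp: successively_Cons)
    show ?case
    proof (cases "R r y")
      case True
      then show ?thesis
        using IH Cons.prems(1) by auto
    next
      case False
      then have "filter (R r) (y # ys) = []"
        using Cons.prems by (intro low) auto
      then show ?thesis
        using IH Cons.prems(1) False by (auto simp: filter_empty_conv)
    qed
  qed simp
qed

text \<open>Occurrences starting at the head are excluded exactly when the upper block, in the sense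
  of \<open>R\<close>, precedes the lower one; the blocks themselves are independent. Filtering by
  the side of r inverts concatenation.\<close>

lemma tails_avoids_last_join:
  fixes R :: "nat \<Rightarrow> nat \<Rightarrow> bool"
  assumes P: "\<And>x y z. P x y z \<longleftrightarrow> R y x \<and> R x z"
    and R: "\<And>x y. R x y \<Longrightarrow> \<not> R y x" "\<And>x y. x \<noteq> y \<Longrightarrow> R x y \<or> R y x"
      "\<And>x y z. R x y \<Longrightarrow> R y z \<Longrightarrow> R x z"
    and S: "r \<in> S"
  shows "bij_betw (\<lambda>(hs, ls). hs @ ls)
    (avoiding_lists P {x \<in> S. R r x} \<times> avoiding_lists P {x \<in> S. R x r}) (tails (avoids_last P) S r)"
proof (rule bij_betwI[where g = "\<lambda>xs. (filter (R r) xs, filter (\<lambda>x. R x r) xs)"])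
  have irrefl: "\<not> R x x" for x
    using R(1) by blast
  have append: "avoids_last P (hs @ ls) \<longleftrightarrow> avoids_last P hs \<and> avoids_last P ls"
    if "set hs \<subseteq> {x. R r x}" "set ls \<subseteq> {x. R x r}" for hs ls
    by (rule avoids_last_append[OF P R(1)], assumption) (use that R(3) in blast)
  have *: "hs @ ls \<in> tails (avoids_last P) S r"
    if h: "hs \<in> avoiding_lists P {x \<in> S. R r x}" and l: "ls \<in> avoiding_lists P {x \<in> S. R x r}" for hs ls
  proof -
    have hl: "set hs = {x \<in> S. R r x}" "set ls = {x \<in> S. R x r}" "distinct hs" "distinct ls"
      "avoids_last P hs" "avoids_last P ls"
      using h l by (auto simp: avoiding_lists_def permutations_of_set_def)
    have "avoids_last P (hs @ ls)"
      using hl by (subst append) auto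
    moreover have no: "\<not> P r x y" if "x \<in> set hs" for x y
      using that hl(1) R(1)[of r x] by (simp add: P)
    have "\<not> P r x y" if "y \<in> set ls" for x y
      using that hl(2) R(1)[of y r] by (simp add: P)
    then have "successively (\<lambda>y z. \<not> P r y z) ls"
      by (simp add: successively_conv_nth)
    moreover have "successively (\<lambda>y z. \<not> P r y z) hs"
      using no by (simp add: successively_conv_nth)
    moreover have "hs = [] \<or> \<not> P r (last hs) y" for y
      using no[of "last hs" y] by auto
    ultimately have "avoids_last P (r # hs @ ls)"
      by (auto simp: successively_append_iff)
    moreover have "insert r (set (hs @ ls)) = S"
      using hl(1,2) R(2) S by auto
    moreover have "distinct (r # hs @ ls)"
      using hl(1-4) R(1) irrefl by auto
    ultimately show ?thesis
      unfolding tails_def permutations_of_set_def by simp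
  qed
  then show "(\<lambda>(hs, ls). hs @ ls) \<in> avoiding_lists P {x \<in> S. R r x} \<times> avoiding_lists P {x \<in> S. R x r}
      \<rightarrow> tails (avoids_last P) S r"
    by auto
  have split: "xs = filter (R r) xs @ filter (\<lambda>x. R x r) xs" and
    mem: "filter (R r) xs \<in> avoiding_lists P {x \<in> S. R r x}"
      "filter (\<lambda>x. R x r) xs \<in> avoiding_lists P {x \<in> S. R x r}"
    if "xs \<in> tails (avoids_last P) S r" for xs
  proof -
    have xs: "insert r (set xs) = S" "distinct (r # xs)" "avoids_last P (r # xs)"
      using that unfolding tails_def permutations_of_set_def by simp_all
    show eq: "xs = filter (R r) xs @ filter (\<lambda>x. R x r) xs"
    proof (rule successively_avoid_eq_append)
      show "R r x \<noteq> R x r" if "x \<in> set xs" for x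
        using that xs(2) R(1)[of r x] R(2)[of r x] by auto
      show "successively (\<lambda>y z. \<not> (R y r \<and> R r z)) xs"
        using xs(3) by (simp add: P)
    qed
    have "avoids_last P (filter (R r) xs @ filter (\<lambda>x. R x r) xs)"
      unfolding eq[symmetric] using xs(3) by simp
    then have "avoids_last P (filter (R r) xs) \<and> avoids_last P (filter (\<lambda>x. R x r) xs)"
      by (subst (asm) append) auto
    then show "filter (R r) xs \<in> avoiding_lists P {x \<in> S. R r x}"
      "filter (\<lambda>x. R x r) xs \<in> avoiding_lists P {x \<in> S. R x r}"
      using xs(1,2) irrefl by (auto simp: avoiding_lists_def permutations_of_set_def)
  qed
  show "(\<lambda>xs. (filter (R r) xs, filter (\<lambda>x. R x r) xs)) \<in> tails (avoids_last P) S r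
      \<rightarrow> avoiding_lists P {x \<in> S. R r x} \<times> avoiding_lists P {x \<in> S. R x r}"
    using mem by blast
  show "(\<lambda>(hs, ls). hs @ ls) (filter (R r) xs, filter (\<lambda>x. R x r) xs) = xs"
    if "xs \<in> tails (avoids_last P) S r" for xs
    using split[OF that] by simp
  show "(filter (R r) ((\<lambda>(hs, ls). hs @ ls) v), filter (\<lambda>x. R x r) ((\<lambda>(hs, ls). hs @ ls) v)) = v"
    if v: "v \<in> avoiding_lists P {x \<in> S. R r x} \<times> avoiding_lists P {x \<in> S. R x r}" for v
  proof -
    obtain hs ls where "v = (hs, ls)" "set hs = {x \<in> S. R r x}" "set ls = {x \<in> S. R x r}"
      using v by (auto simp: avoiding_lists_def permutations_of_set_def)
    then show ?thesis
      using R(1) by (auto simp: filter_empty_conv filter_id_conv)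
  qed
qed

text \<open>Each head contributes the product of the counts of its two blocks. Summing over heads by
  rank yields the Catalan convolution, which settles the block counts by induction.\<close>

lemma card_avoiding_lists:
  fixes R :: "nat \<Rightarrow> nat \<Rightarrow> bool"
  assumes P: "\<And>x y z. P x y z \<longleftrightarrow> R y x \<and> R x z" and R: "R = (<) \<or> R = (>)"
    and "finite V"
  shows "card (avoiding_lists P V) = catalan (card V)"
    and "r \<in> V \<Longrightarrow> card (tails (avoids_last P) V r) = catalan (below V r) * catalan (above V r)"
proof -
  have tails: "card (tails (avoids_last P) V r) =
      card (avoiding_lists P {x \<in> V. x < r}) * card (avoiding_lists P {x \<in> V. r < x})"
    if "r \<in> V" for r V
  proof -
    have "bij_betw (\<lambda>(hs, ls). hs @ ls)
      (avoiding_lists P {x \<in> V. R r x} \<times> avoiding_lists P {x \<in> V. R x r}) (tails (avoids_last P) V r)"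
      using R by (intro tails_avoids_last_join[OF P _ _ _ that]) auto
    \<comment> \<open>For \<open>R = (>)\<close> the two factors change places.\<close>
    then show ?thesis
      using R by (auto simp: bij_betw_same_card[symmetric] card_cartesian_product)
  qed
  have fin: "finite (avoiding_lists P V)" for V
    by (rule finite_subset[of _ "permutations_of_set V"]) (auto simp: avoiding_lists_def)
  have lists: "card (avoiding_lists P V) = catalan (card V)" if "finite V" for V
    using that
  proof (induction "card V" arbitrary: V rule: less_induct)
    case less
    show ?case
    proof (cases "card V")
      case 0
      then have "avoiding_lists P V = {[]}"
        using less.prems by (auto simp: avoiding_lists_def)
      then show ?thesis
        using 0 by simp
    next
      case (Suc n)
      have "avoiding_lists P V = (\<Union>r\<in>V. (#) r ` tails (avoids_last P) V r)" (is "?A = ?B")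
      proof (intro equalityI subsetI)
        fix xs assume xs: "xs \<in> ?A"
        then obtain r ys where "xs = r # ys" "r \<in> V"
          using Suc by (cases xs) (auto simp: avoiding_lists_def permutations_of_set_def)
        then show "xs \<in> ?B"
          using xs by (auto simp: avoiding_lists_def tails_def)
      qed (auto simp: avoiding_lists_def tails_def)
      then have "card (avoiding_lists P V) = (\<Sum>r\<in>V. card ((#) r ` tails (avoids_last P) V r))"
        using less.prems by (simp only:, intro card_UN_disjoint) auto
      also have "\<dots> = (\<Sum>r\<in>V. catalan (below V r) * catalan (n - below V r))"
      proof (rule sum.cong)
        fix r assume r: "r \<in> V"
        have "card {x \<in> V. x < r} < card V" "card {x \<in> V. r < x} < card V"
          using r less.prems by (auto intro!: psubset_card_mono)
        then have "card (tails (avoids_last P) V r) = catalan (below V r) * catalan (above V r)"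
          using tails[OF r] less by (simp add: below_def above_def)
        moreover have "above V r = n - below V r"
          using card_split_at[OF less.prems r] Suc by simp
        ultimately show "card ((#) r ` tails (avoids_last P) V r) =
            catalan (below V r) * catalan (n - below V r)"
          by (simp add: card_image)
      qed simp
      also have "\<dots> = (\<Sum>i\<le>n. catalan i * catalan (n - i))"
        using sum_over_ranks[OF less.prems, of "\<lambda>i. catalan i * catalan (n - i)"] Suc
        by (simp add: lessThan_Suc_atMost)
      finally show ?thesis
        using Suc by (simp add: catalan.simps)
    qed
  qed
  show "card (avoiding_lists P V) = catalan (card V)"
    using lists assms(3) .
  show "card (tails (avoids_last P) V r) = catalan (below V r) * catalan (above V r)" if "r \<in> V"
    using tails[OF that] lists assms(3) by (simp add: below_def above_def)
qed

lemma count_last213: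
  assumes "finite S" "r \<in> S"
  shows "card (tails (avoids (AdjLast 2 1 3)) S r) = catalan (below S r) * catalan (above S r)"
  unfolding avoids.simps
  by (rule card_avoiding_lists(2)[where R = "(<)"]) (auto simp: is_pattern_def assms)

lemma count_last231:
  assumes "finite S" "r \<in> S"
  shows "card (tails (avoids (AdjLast 2 3 1)) S r) = catalan (below S r) * catalan (above S r)"
  unfolding avoids.simps
  by (rule card_avoiding_lists(2)[where R = "(>)"]) (auto simp: is_pattern_def assms)

section \<open>Bell and ballot numbers\<close>

lemma below_interval: "1 \<le> r \<Longrightarrow> r \<le> n \<Longrightarrow> below {1..n} r = r - 1"
proof -
  assume "1 \<le> r" "r \<le> n"
  then have "{x \<in> {1..n}. x < r} = {1..<r}"
    by auto
  then show ?thesis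
    by (simp add: below_def)
qed

lemma above_interval: "1 \<le> r \<Longrightarrow> r \<le> n \<Longrightarrow> above {1..n} r = n - r"
proof -
  assume "1 \<le> r" "r \<le> n"
  then have "{x \<in> {1..n}. r < x} = {r<..n}"
    by auto
  then show ?thesis
    by (simp add: above_def)
qed

lemma vincular_patterns_eq:
  "vincular_patterns =
    {AdjLast 1 2 3, AdjLast 1 3 2, AdjLast 2 1 3, AdjLast 2 3 1, AdjLast 3 1 2, AdjLast 3 2 1,
     AdjFirst 1 2 3, AdjFirst 1 3 2, AdjFirst 2 1 3, AdjFirst 2 3 1, AdjFirst 3 1 2, AdjFirst 3 2 1}"
proof -
  have *: "distinct [a, b, c] \<and> {a, b, c} = {1..3} \<longleftrightarrow>
      (a, b, c) \<in> {(1, 2, 3), (1, 3, 2), (2, 1, 3), (2, 3, 1), (3, 1, 2), (3, 2, 1)}" for a b c :: nat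
  proof -
    have eq: "{1..3} = {1, 2, 3 :: nat}"
      by auto
    show ?thesis
    proof
      assume *: "distinct [a, b, c] \<and> {a, b, c} = {1..3}"
      then have "a \<in> {1, 2, 3}" "b \<in> {1, 2, 3}" "c \<in> {1, 2, 3}"
        unfolding eq by blast+
      then show "(a, b, c) \<in> {(1, 2, 3), (1, 3, 2), (2, 1, 3), (2, 3, 1), (3, 1, 2), (3, 2, 1)}"
        using * by auto
    qed (auto simp: eq)
  qed
  show ?thesis
    unfolding vincular_patterns_def * by auto
qed

lemma card_avoiders_by_ranks:
  assumes "\<And>S r. finite S \<Longrightarrow> r \<in> S \<Longrightarrow> card (tails (avoids \<sigma>) S r) = f (below S r) (above S r)"
    and "1 \<le> r" "r \<le> n"
  shows "card (avoiders n r \<sigma>) = f (r - 1) (n - r)"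
  using assms(2,3) card_avoiders[of n r \<sigma>]
  by (simp add: assms(1) below_interval[simplified] above_interval[simplified])

text \<open>The complemented permutation has head n + 1 - r, so the two ranks trade places.\<close>

lemma card_avoiders_flip_by_ranks:
  assumes "\<And>S r. finite S \<Longrightarrow> r \<in> S \<Longrightarrow> card (tails (avoids \<sigma>) S r) = f (below S r) (above S r)"
    and "\<sigma> \<in> vincular_patterns" "1 \<le> r" "r \<le> n"
  shows "card (avoiders n r (flip \<sigma>)) = f (n - r) (r - 1)"
proof -
  have "card (avoiders n (n + 1 - r) \<sigma>) = f (n + 1 - r - 1) (n - (n + 1 - r))"
    using assms(3,4) by (intro card_avoiders_by_ranks assms(1)) auto
  moreover have "n + 1 - r - 1 = n - r" "n - (n + 1 - r) = r - 1"
    using assms(3,4) by auto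
  ultimately show ?thesis
    using card_avoiders_flip[OF assms(2-4)] by simp
qed

lemma card_avoiders_eq:
  assumes "1 \<le> r" "r \<le> n"
  shows "card (avoiders n r (AdjLast 1 2 3)) = count_split_min (r - 1) (n - r)"
    and "card (avoiders n r (AdjLast 1 3 2)) = count_split_min (r - 1) (n - r)"
    and "card (avoiders n r (AdjLast 2 1 3)) = catalan (r - 1) * catalan (n - r)"
    and "card (avoiders n r (AdjLast 2 3 1)) = catalan (r - 1) * catalan (n - r)"
    and "card (avoiders n r (AdjLast 3 1 2)) = count_split_min (n - r) (r - 1)"
    and "card (avoiders n r (AdjLast 3 2 1)) = count_split_min (n - r) (r - 1)"
    and "card (avoiders n r (AdjFirst 1 2 3)) = count123 (r - 1) (n - r)"
    and "card (avoiders n r (AdjFirst 1 3 2)) = ballot (n - 1) (r - 1)"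
    and "card (avoiders n r (AdjFirst 2 1 3)) = count213 (r - 1) (n - r)"
    and "card (avoiders n r (AdjFirst 2 3 1)) = count213 (n - r) (r - 1)"
    and "card (avoiders n r (AdjFirst 3 1 2)) = ballot (n - 1) (n - r)"
    and "card (avoiders n r (AdjFirst 3 2 1)) = count123 (n - r) (r - 1)"
proof -
  note direct = card_avoiders_by_ranks[OF _ assms]
  note flipped = card_avoiders_flip_by_ranks[OF _ _ assms]
  note pats = vincular_patterns_eq
  show "card (avoiders n r (AdjLast 1 2 3)) = count_split_min (r - 1) (n - r)"
    by (rule direct[OF count_last123])
  show "card (avoiders n r (AdjLast 1 3 2)) = count_split_min (r - 1) (n - r)"
    by (rule direct[OF count_last132])
  show "card (avoiders n r (AdjLast 2 1 3)) = catalan (r - 1) * catalan (n - r)"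
    by (rule direct[OF count_last213])
  show "card (avoiders n r (AdjLast 2 3 1)) = catalan (r - 1) * catalan (n - r)"
    by (rule direct[OF count_last231])
  show "card (avoiders n r (AdjLast 3 1 2)) = count_split_min (n - r) (r - 1)"
    using flipped[OF count_last132] by (simp add: pats)
  show "card (avoiders n r (AdjLast 3 2 1)) = count_split_min (n - r) (r - 1)"
    using flipped[OF count_last123] by (simp add: pats)
  show "card (avoiders n r (AdjFirst 1 2 3)) = count123 (r - 1) (n - r)"
    by (rule direct[OF count_first123])
  show "card (avoiders n r (AdjFirst 1 3 2)) = ballot (n - 1) (r - 1)"
    using direct[of "AdjFirst 1 3 2" "\<lambda>p q. ballot (p + q) p", OF count_first132] assms by simp
  show "card (avoiders n r (AdjFirst 2 1 3)) = count213 (r - 1) (n - r)"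
    by (rule direct[OF count_first213])
  show "card (avoiders n r (AdjFirst 2 3 1)) = count213 (n - r) (r - 1)"
    using flipped[OF count_first213] by (simp add: pats)
  show "card (avoiders n r (AdjFirst 3 1 2)) = ballot (n - 1) (n - r)"
    using flipped[of "AdjFirst 1 3 2" "\<lambda>p q. ballot (p + q) p", OF count_first132] assms
    by (simp add: pats)
  show "card (avoiders n r (AdjFirst 3 2 1)) = count123 (n - r) (r - 1)"
    using flipped[OF count_first123] by (simp add: pats)
qed

section \<open>Growth of the Bell numbers\<close>

lemma bell_less_Suc:
  assumes "1 \<le> n"
  shows "bell n < bell (Suc n)"
proof -
  have "(\<Sum>k\<in>{0, n}. (n choose k) * bell k) \<le> bell (Suc n)"
    unfolding bell.simps by (intro sum_mono2) auto
  then show ?thesis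
    using assms by simp
qed

lemma bell_le_Suc: "bell n \<le> bell (Suc n)"
  using bell_less_Suc[of n] by (cases n) (auto simp: bell.simps)

lemma bell_Suc_Suc: "bell (Suc (Suc n)) = (\<Sum>k\<le>n. (n choose k) * (bell k + bell (Suc k)))"
  unfolding bell.simps(2)[of "Suc n"] by (rule sum_binomial_Suc)

text \<open>Termwise comparison of B_k + B_{k+1} with B_k + B_k under the same binomial
  weights.\<close>

lemma two_bell_le: "2 * bell (Suc n) \<le> bell (Suc (Suc n))"
proof -
  have "2 * bell (Suc n) = (\<Sum>k\<le>n. (n choose k) * (bell k + bell k))"
    by (simp add: bell.simps(2) sum_distrib_left mult_2[symmetric] ac_simps)
  also have "\<dots> \<le> bell (Suc (Suc n))"
    unfolding bell_Suc_Suc by (intro sum_mono mult_left_mono add_mono bell_le_Suc) auto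
  finally show ?thesis .
qed

lemma two_bell_less:
  assumes "1 \<le> n"
  shows "2 * bell (Suc n) < bell (Suc (Suc n))"
proof -
  have "2 * bell (Suc n) = (\<Sum>k\<le>n. (n choose k) * (bell k + bell k))"
    by (simp add: bell.simps(2) sum_distrib_left mult_2[symmetric] ac_simps)
  also have "\<dots> < bell (Suc (Suc n))"
    unfolding bell_Suc_Suc using bell_less_Suc[OF assms] bell_le_Suc
    by (intro sum_strict_mono_ex1) auto
  finally show ?thesis .
qed

text \<open>With n = m + 1 the difference B_{m+2} - 3 B_{m+1} is the binomial sum of g k = B_{k+1} -
  2 B_k. The only negative term is g 0 = -1, and g m >= 1 makes up for it.\<close>

lemma three_bell_le:
  assumes "3 \<le> n"
  shows "3 * bell n \<le> bell (Suc n)"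
proof -
  obtain m where m: "n = Suc m" "2 \<le> m"
    using assms by (cases n) auto
  define g where "g k = int (bell (Suc k)) - 2 * int (bell k)" for k
  have g: "0 \<le> g k" if "1 \<le> k" for k
    using that two_bell_le[of "k - 1"] by (simp add: g_def)
  have "2 * bell m < bell (Suc m)"
    using m(2) two_bell_less[of "m - 1"] by (cases m) auto
  then have "1 \<le> g m"
    by (simp add: g_def)
  moreover have "(\<Sum>k\<in>{m}. int (m choose k) * g k) \<le> (\<Sum>k\<in>{1..m}. int (m choose k) * g k)"
    using m g by (intro sum_mono2) auto
  moreover have "(\<Sum>k\<le>m. int (m choose k) * g k) = g 0 + (\<Sum>k\<in>{1..m}. int (m choose k) * g k)"
    by (simp add: atMost_atLeast0 sum.atLeast_Suc_atMost)
  moreover have "g 0 = - 1"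
    by (simp add: g_def bell.simps)
  ultimately have "0 \<le> (\<Sum>k\<le>m. int (m choose k) * g k)"
    by simp
  also have "\<dots> = (\<Sum>k\<le>m. int ((m choose k) * (bell k + bell (Suc k))) - 3 * int ((m choose k) * bell k))"
    by (intro sum.cong) (auto simp: g_def algebra_simps)
  also have "\<dots> = int (bell (Suc (Suc m))) - 3 * int (bell (Suc m))"
    by (simp only: sum_subtractf sum_distrib_left[symmetric] of_nat_sum[symmetric] bell_Suc_Suc bell.simps(2)[of m])
  finally show ?thesis
    using m by simp
qed

section \<open>Ballot numbers and their diagonal\<close>

lemma ballot_0 [simp]: "ballot n 0 = 1"
  by (induction n) auto

lemma ballot_1: "ballot (Suc n) 1 = Suc n"
  by (induction n) auto

lemma ballot_mono: "p \<le> q \<Longrightarrow> ballot n p \<le> ballot n q"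
  by (cases n) (auto intro!: sum_mono2)

text \<open>Both recurrences sum over i < p and differ only in the extra term for p < n + 1:
  \<open>ballot n p\<close> is at most \<open>ballot n n\<close>, which by induction is at most
  \<open>count123 n 0\<close>.\<close>

lemma ballot_le_count123: "p \<le> n \<Longrightarrow> ballot n p \<le> count123 p (n - p)"
proof (induction n arbitrary: p)
  case (Suc n)
  have le: "(\<Sum>i<p. ballot n i) \<le> (\<Sum>i<p. count123 i (n - i))"
    using Suc by (intro sum_mono) auto
  have rec: "count123 p (Suc n - p) = (\<Sum>i<p. count123 i (n - i)) + (if p = Suc n then 0 else count123 n 0)"
    using count123_step[of p "Suc n - p"] Suc.prems by auto
  show ?case
  proof (cases "p = Suc n")
    case True
    then show ?thesis
      using le rec by (simp add: lessThan_Suc_atMost)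
  next
    case False
    then have "ballot (Suc n) p = (\<Sum>i<Suc p. ballot n i)"
      using Suc.prems by (simp add: lessThan_Suc_atMost min_def del: sum.lessThan_Suc)
    moreover have "ballot n p \<le> count123 n 0"
      using ballot_mono[of p n n] Suc.IH[of n] Suc.prems False by simp
    ultimately show ?thesis
      using le rec False by simp
  qed
qed (simp add: count123_def)

text \<open>The previous comparison is strict in the summand i = 0, where 1 stands against
  \<open>bell (m - 1)\<close>; here m - 1 >= 2.\<close>

lemma ballot_diag_less_bell:
  assumes "4 \<le> n"
  shows "ballot n n < bell n"
proof -
  obtain m where m: "n = Suc m" "3 \<le> m"
    using assms by (cases n) auto
  have "bell 1 < bell (m - 1)"
  proof -
    have "bell 1 < bell (Suc 1)"
      by (rule bell_less_Suc) simp
    also have "\<dots> \<le> bell (m - 1)"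
      by (rule lift_Suc_mono_le[of bell, OF bell_le_Suc]) (use m(2) in simp)
    finally show ?thesis .
  qed
  then have "ballot m 0 < count123 0 (m - 0)"
    using m(2) by (simp add: count123_def bell.simps)
  then have "(\<Sum>i<n. ballot m i) < (\<Sum>i<n. count123 i (m - i))"
    using m ballot_le_count123[of _ m] by (intro sum_strict_mono_ex1 bexI[of _ 0]) auto
  also have "\<dots> = bell n"
    using count123_step[of n 0] m by (simp add: count123_def)
  finally show ?thesis
    using m by (simp add: lessThan_Suc_atMost)
qed

text \<open>The reflection formula. Both sides obey the same two-term recurrence, and on the
  diagonal the term missing from the ballot recurrence is one where the formula vanishes.\<close>

lemma ballot_closed_form:
  assumes "p \<le> n"
  shows "int (ballot n p) = int ((n + p) choose p) - (if p = 0 then 0 else int ((n + p) choose (p - 1)))"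
  using assms
proof (induction n arbitrary: p)
  case (Suc n)
  define t where "t n p = int ((n + p) choose p) - (if p = 0 then 0 else int ((n + p) choose (p - 1)))"
    for n p :: nat
  have rec: "t (Suc n) (Suc p) = t (Suc n) p + t n (Suc p)" for p
    by (cases p) (simp_all add: t_def)
  \<comment> \<open>Just beyond the diagonal the two binomial coefficients are the symmetric middle
    ones of row 2n + 1.\<close>
  have zero: "t n (Suc n) = 0"
    using binomial_symmetric[of n "Suc (2 * n)"] by (simp add: t_def mult_2)
  have IH: "int (ballot n p) = t n p" if "p \<le> n" for p
    using Suc.IH[OF that] by (simp add: t_def)
  have "int (ballot (Suc n) p) = t (Suc n) p" if "p \<le> Suc n" for p
    using that
  proof (induction p)
    case 0
    then show ?case
      by (simp add: t_def)
  next
    case (Suc p)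
    then show ?case
    proof (cases "p = n")
      case True
      then show ?thesis
        using Suc rec[of p] zero by simp
    next
      case False
      then have "ballot (Suc n) (Suc p) = ballot (Suc n) p + ballot n (Suc p)"
        using Suc.prems by (simp add: min_def)
      then show ?thesis
        using Suc rec[of p] IH[of "Suc p"] False by simp
    qed
  qed
  then show ?case
    using Suc.prems by (simp add: t_def)
qed simp

text \<open>The closed form on the diagonal is a difference of two neighbouring binomial
  coefficients whose ratio is n : (n + 1). This is the usual formula for Catalan numbers.\<close>

lemma Suc_times_ballot_diag: "Suc n * ballot n n = (2 * n) choose n"
proof (cases n)
  case (Suc m)
  have "Suc m * ((2 * n) choose n) = Suc n * ((2 * n) choose m)"
    using Suc_times_binomial_add[of m n] Suc by (simp add: mult_2)
  then have "int (Suc m) * int ((2 * n) choose n) = int (Suc n) * int ((2 * n) choose m)"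
    by (metis of_nat_mult)
  moreover have "int (ballot n n) = int ((2 * n) choose n) - int ((2 * n) choose m)"
    using ballot_closed_form[of n n] Suc by (simp add: mult_2)
  moreover have "(a + 1) * b = x" if "a * x = (a + 1) * y" "b = x - y" for a b x y :: int
    unfolding that(2) right_diff_distrib that(1)[symmetric] by (simp add: algebra_simps)
  moreover have "int (Suc n) = int (Suc m) + 1"
    using Suc by simp
  ultimately have "int (Suc n) * int (ballot n n) = int ((2 * n) choose n)"
    by metis
  then show ?thesis
    by (metis of_nat_eq_iff of_nat_mult)
qed simp

text \<open>Two absorption identities link the central binomial coefficients of rows 2n + 2 and 2n.
  The factor (n + 1)^2 clears denominators and is cancelled at the end.\<close>

lemma ballot_diag_ratio: "Suc (Suc n) * ballot (Suc n) (Suc n) = 2 * Suc (2 * n) * ballot n n"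
proof -
  have "Suc (2 * n) choose n = Suc (2 * n) choose Suc n"
    using binomial_symmetric[of n "Suc (2 * n)"] by simp
  then have a: "Suc n * (Suc (2 * n) choose n) = Suc (2 * n) * ((2 * n) choose n)"
    using Suc_times_binomial_eq[of "2 * n" n] by simp
  have b: "Suc n * (2 * Suc n choose Suc n) = (2 * Suc n) * (Suc (2 * n) choose n)"
    using Suc_times_binomial_eq[of "Suc (2 * n)" n] by (simp add: algebra_simps)
  have "Suc n * (Suc n * (Suc (Suc n) * ballot (Suc n) (Suc n))) =
      2 * Suc n * (Suc n * (Suc (2 * n) choose n))"
    unfolding Suc_times_ballot_diag b by (simp only: ac_simps)
  also have "\<dots> = 2 * Suc n * (Suc (2 * n) * (Suc n * ballot n n))"
    unfolding a Suc_times_ballot_diag ..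
  also have "\<dots> = Suc n * (Suc n * (2 * Suc (2 * n) * ballot n n))"
    by (simp only: ac_simps)
  finally show ?thesis
    unfolding Suc_mult_cancel1 .
qed

lemma ballot_diag_pos: "0 < ballot n n"
  using ballot_mono[of 0 n n] by simp

text \<open>The ratio of consecutive terms is (4n + 2) / (n + 2), which is below 4.\<close>

lemma ballot_diag_less_4: "ballot (Suc n) (Suc n) < 4 * ballot n n"
proof -
  have "Suc (Suc n) * ballot (Suc n) (Suc n) < Suc (Suc n) * (4 * ballot n n)"
    unfolding ballot_diag_ratio using ballot_diag_pos[of n] by simp
  then show ?thesis
    by (rule mult_less_cancel1[THEN iffD1, THEN conjunct2])
qed

lemma ballot_diag_less_Suc:
  assumes "1 \<le> n"
  shows "ballot n n < ballot (Suc n) (Suc n)"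
proof -
  have "(\<Sum>i\<in>{0, n}. ballot n i) \<le> ballot (Suc n) (Suc n)"
    by (simp, intro sum_mono2) auto
  then show ?thesis
    using assms by simp
qed

section \<open>Separation of the nine classes\<close>

lemma quotient_eqI:
  assumes "equiv A W" "\<Union>P = A" "{} \<notin> P"
    and in_class: "\<And>C x y. C \<in> P \<Longrightarrow> x \<in> C \<Longrightarrow> y \<in> C \<Longrightarrow> (x, y) \<in> W"
    and separated: "\<And>C D x y. C \<in> P \<Longrightarrow> D \<in> P \<Longrightarrow> x \<in> C \<Longrightarrow> y \<in> D \<Longrightarrow> (x, y) \<in> W \<Longrightarrow> C = D"
  shows "A // W = P"
proof -
  have class_eq: "W `` {x} = C" if "C \<in> P" "x \<in> C" for C x
  proof (intro equalityI subsetI)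
    fix y assume y: "y \<in> W `` {x}"
    then have "y \<in> A"
      using equiv_type[OF assms(1)] by auto
    then obtain D where "D \<in> P" "y \<in> D"
      using assms(2) by blast
    then show "y \<in> C"
      using separated[of C D x y] that y by auto
  qed (use in_class that in auto)
  show ?thesis
  proof (intro equalityI subsetI)
    fix C assume "C \<in> A // W"
    then obtain x where "C = W `` {x}" "x \<in> \<Union>P"
      unfolding quotient_def assms(2) by blast
    then show "C \<in> P"
      using class_eq by auto
  next
    fix C assume "C \<in> P"
    then obtain x where "x \<in> C"
      using assms(3) by (metis ex_in_conv)
    then show "C \<in> A // W"
      using class_eq[OF \<open>C \<in> P\<close>] \<open>C \<in> P\<close> assms(2) by (auto simp: quotient_def)
  qed
qed

theorem theorem7p12:
  fixes r :: nat
  assumes "r \<ge> 5"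
  shows "card vincular_patterns = 12 \<and>
    card (vincular_patterns // wilf_rel r) = 9 \<and>
    vincular_patterns // wilf_rel r =
     {{AdjLast 2 1 3, AdjLast 2 3 1},
      {AdjLast 1 2 3, AdjLast 1 3 2},
      {AdjLast 3 2 1, AdjLast 3 1 2},
      {AdjFirst 1 3 2}, {AdjFirst 3 1 2}, {AdjFirst 1 2 3},
      {AdjFirst 2 1 3}, {AdjFirst 2 3 1}, {AdjFirst 3 2 1}}"
    (is "_ \<and> _ \<and> _ = ?P")
proof -
  obtain p where p: "r = Suc p" "4 \<le> p"
    using assms by (cases r) auto
  obtain p' where p': "p = Suc p'" "3 \<le> p'"
    using p(2) by (cases p) auto
  \<comment> \<open>Three lengths, n = r, r + 1 and r + 2, suffice to tell the classes apart; below
    the head there are p = r - 1 entries.\<close>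
  define N where "N i \<sigma> = card (avoiders (r + i) r \<sigma>)" for i \<sigma>
  define b0 b1 b2 b3 where b: "b0 = bell p'" "b1 = bell p" "b2 = bell (Suc p)" "b3 = bell (Suc (Suc p))"
  define c1 c2 k t where c: "c1 = ballot p p" "c2 = ballot (Suc p) (Suc p)" "k = catalan p" "t = (2::nat) ^ p"
  have "bell 1 < bell (Suc 1)"
    by (rule bell_less_Suc) simp
  also have "\<dots> \<le> b0"
    unfolding b by (rule lift_Suc_mono_le[of bell, OF bell_le_Suc]) (use p'(2) in simp)
  finally have "2 \<le> b0"
    by (simp add: bell.simps)
  moreover have "3 * b0 \<le> b1" "3 * b1 \<le> b2" "b2 \<le> b3"
    using three_bell_le[of p'] three_bell_le[of p] p p' bell_le_Suc by (simp_all add: b)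
  moreover have "1 < c1"
    using ballot_diag_less_Suc[of p'] ballot_diag_pos[of p'] p' unfolding c by simp
  moreover have "c1 < b1" "c1 < c2" "c2 < 4 * c1"
    using ballot_diag_less_bell[of p] ballot_diag_less_Suc[of p] ballot_diag_less_4[of p] p
    unfolding b c by simp_all
  \<comment> \<open>This separates 31-2 from the class of 3-12: both have one avoider at n = r, but
    \<open>Suc p\<close> against 2^p at n = r + 1.\<close>
  moreover have "Suc p < t"
  proof -
    have "p' < 2 ^ p'"
      by simp
    then show ?thesis
      unfolding c p'(1) power_Suc using p'(2) by linarith
  qed
  ultimately have ineqs: "2 \<le> b0" "3 * b0 \<le> b1" "3 * b1 \<le> b2" "b2 \<le> b3"
    "1 < c1" "c1 < b1" "c1 < c2" "c2 < 4 * c1" "Suc p < t"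
    by simp_all
  have N_eq: "N i (AdjLast 1 2 3) = count_split_min p i"
    "N i (AdjLast 1 3 2) = count_split_min p i"
    "N i (AdjLast 2 1 3) = catalan p * catalan i"
    "N i (AdjLast 2 3 1) = catalan p * catalan i"
    "N i (AdjLast 3 1 2) = count_split_min i p"
    "N i (AdjLast 3 2 1) = count_split_min i p"
    "N i (AdjFirst 1 2 3) = count123 p i"
    "N i (AdjFirst 1 3 2) = ballot (p + i) p"
    "N i (AdjFirst 2 1 3) = count213 p i"
    "N i (AdjFirst 2 3 1) = count213 i p"
    "N i (AdjFirst 3 1 2) = ballot (p + i) i"
    "N i (AdjFirst 3 2 1) = count123 i p" for i
    using card_avoiders_eq[of r "r + i"] p(1) unfolding N_def by simp_all
  have N0: "N 0 (AdjLast 1 2 3) = b1" "N 0 (AdjLast 1 3 2) = b1"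
    "N 0 (AdjLast 2 1 3) = k" "N 0 (AdjLast 2 3 1) = k"
    "N 0 (AdjLast 3 1 2) = 1" "N 0 (AdjLast 3 2 1) = 1"
    "N 0 (AdjFirst 1 2 3) = b1" "N 0 (AdjFirst 1 3 2) = c1"
    "N 0 (AdjFirst 2 1 3) = b1" "N 0 (AdjFirst 2 3 1) = b1"
    "N 0 (AdjFirst 3 1 2) = 1" "N 0 (AdjFirst 3 2 1) = b0"
    unfolding N_eq using p' bell_sum_diag[of p']
    by (simp_all add: b c count_split_min_0 count123_def count213_def)
  \<comment> \<open>The value for 23-1 is b2 - b1, written additively because of truncated
    subtraction.\<close>
  have N1: "N 1 (AdjLast 1 2 3) = b2" "N 1 (AdjLast 1 3 2) = b2"
    "N 1 (AdjLast 2 1 3) = k" "N 1 (AdjLast 2 3 1) = k"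
    "N 1 (AdjLast 3 1 2) = t" "N 1 (AdjLast 3 2 1) = t"
    "N 1 (AdjFirst 1 2 3) = b2" "N 1 (AdjFirst 1 3 2) = c2"
    "N 1 (AdjFirst 2 1 3) = b1" "N 1 (AdjFirst 2 3 1) + b1 = b2"
    "N 1 (AdjFirst 3 1 2) = Suc p" "N 1 (AdjFirst 3 2 1) = b1 + b0"
    unfolding N_eq using p' bell_sum_diag[of p'] bell_sum_diag[of p] bell_sum_Suc[of p' p']
      bell_sum_Suc[of p' 0] count_split_min_1 ballot_1[of p]
    by (simp_all add: b c count123_def count213_def catalan.simps count_split_min_Suc_0
        del: count_split_min.simps)
  \<comment> \<open>Ties over the first two lengths are broken here: 1-23 and 12-3 share b1, b2 and
    then have b3 - b1 against b3 - b2; the values k, k of 2-13 could match b1, b1 of 21-3, but 2 b1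
    < b2 + b1.\<close>
  have N2: "N 2 (AdjLast 1 2 3) + b1 = b3" "N 2 (AdjLast 1 3 2) + b1 = b3"
    "N 2 (AdjLast 2 1 3) = 2 * k" "N 2 (AdjLast 2 3 1) = 2 * k"
    "N 2 (AdjFirst 1 2 3) + b2 = b3" "N 2 (AdjFirst 2 1 3) = b2 + b1"
    unfolding N_eq using count_split_min_2[of p] bell_sum_diag[of "Suc p"] bell_sum_diag[of p]
      bell_sum_Suc[of p p] bell_sum_Suc[of p 0]
    by (simp_all add: b c count123_def count213_def catalan.simps numeral_2_eq_2)
  have r1: "1 \<le> r"
    using assms by simp
  have "vincular_patterns // wilf_rel r = ?P"
  proof (rule quotient_eqI[OF equiv_wilf_rel])
    show "\<Union>?P = vincular_patterns"
      by (auto simp: vincular_patterns_eq)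
    show "(x, y) \<in> wilf_rel r" if "C \<in> ?P" "x \<in> C" "y \<in> C" for C x y
    proof -
      have "x \<in> vincular_patterns" "y \<in> vincular_patterns"
        using that by (auto simp: vincular_patterns_eq)
      moreover have "card (avoiders n r x) = card (avoiders n r y)" if "r \<le> n" for n
      proof -
        have "\<forall>C\<in>?P. \<forall>x\<in>C. \<forall>y\<in>C. card (avoiders n r x) = card (avoiders n r y)"
          by (simp add: card_avoiders_eq(1-6)[OF r1 that] del: One_nat_def)
        from this[rule_format, OF \<open>C \<in> ?P\<close> \<open>x \<in> C\<close> \<open>y \<in> C\<close>] show ?thesis .
      qed
      ultimately show ?thesis
        by (simp add: wilf_rel_def)
    qed
    show "C = D" if CD: "C \<in> ?P" "D \<in> ?P" "x \<in> C" "y \<in> D" and xy: "(x, y) \<in> wilf_rel r" for C D x y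
    proof -
      \<comment> \<open>Each pair of distinct blocks leads to a linear contradiction. The delicate
        pair is 13-2 and 32-1: from c1 = b0 and c2 = b1 + b0 it would follow that c2 >= 4 b0 = 4 c1,
        against c2 < 4 c1.\<close>
      have "\<forall>C\<in>?P. \<forall>D\<in>?P. \<forall>x\<in>C. \<forall>y\<in>D. N 0 x = N 0 y \<longrightarrow> N 1 x = N 1 y \<longrightarrow> N 2 x = N 2 y \<longrightarrow> C = D"
        unfolding Set.ball_simps simp_thms N0 N1(1-9,11,12) N2(3,4,6)
        by (intro conjI impI; (rule refl | (rule FalseE; insert p(2) ineqs N1(10) N2(1,2,5); linarith)))
      note this[rule_format, OF CD]
      moreover have "N i x = N i y" for i
        using xy by (simp add: wilf_rel_def N_def)
      ultimately show ?thesis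
        by blast
    qed
  qed simp
  moreover have "card ?P = 9"
    by (simp add: doubleton_eq_iff)
  ultimately show ?thesis
    by (simp add: vincular_patterns_eq)
qed

end
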